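(* Let $p:\mathbb{R}^d\to(0,\infty)$ be a twice continuously differentiable pdf on $\mathbb{R}^d$ with $$\int\frac{\|\nabla p\|^2}{p}<\infty\quad\text{and}\quad\int\|\nabla^2 p\|<\infty,$$ and such that $p$ has finite variance. For $i=1,\dots,d$ denote by $p_i$ the marginal density of $p$ in direction $e_i$, by $\rho_i(x_i)=p_i'(x_i)/p_i(x_i)$ its score function, and by $\tau_i^{(1)}$ the Stein kernel of the marginal $p_i$. Then, for any direction $e_i$, $i=1,\dots,d$, there exists a Stein kernel $\tau_{p,i}^{(d)}$ for $p$ in direction $e_i$ of the form $$\tau_{p,i}^{(d)}(x)=\tau_i^{(1)}(x_i)\,\bigl(\tau_{i,1}^{(d)}(x\mid x_i),\dots,\tau_{i,i-1}^{(d)}(x\mid x_i),\,1,\,\tau_{i,i+1}^{(d)}(x\mid x_i),\dots,\tau_{i,d}^{(d)}(x\mid x_i)\bigr)^T,$$ where the vector field $x=(x_1,\dots,x_d)\mapsto\tau_i^{(d)}(x\mid x_i)$, with components $\tau_{i,j}^{(d)}(x\mid x_i)$ for $j\ne i$ and $i$-th component equal to $1$, solves, as a function of $x$, the equation $$\frac{1}{p(x)}\,\mathrm{div}_x\bigl(\tau_i^{(d)}(x\mid x_i)\,p(x)\bigr)=\rho_i(x_i).$$ Moreover, the $i$-th component of $\tau_{p,i}^{(d)}(x)$ is $\tau_i^{(1)}(x_i)$.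
   Context: The univariate (marginal) Stein kernel of a univariate density $p_i$ with mean $\nu_i$ is $\tau_i^{(1)}(u)=\frac{1}{p_i(u)}\int_{-\infty}^{u}(\nu_i-v)\,p_i(v)\,dv$. For a pdf $p$ on $\mathbb{R}^d$ with finite mean $\nu$ and open support $\Omega_p=\{p>0\}$, a Stein kernel for $p$ in direction $e_i$ (the $i$-th canonical basis vector) is a vector field $\tau_i=(\tau_{i1},\dots,\tau_{id})$ on $\Omega_p$ with $\tau_{ij}p\in\mathrm{ACL}^1_{\mathrm{loc}}(\Omega_p)$ for all $j$ and, for Lebesgue-almost all $x\in\Omega_p$, $\frac{1}{p(x)}\sum_{j=1}^d\partial_j(\tau_{ij}p)(x)=\nu_i-x_i$. $\mathrm{ACL}(\Omega)$: Borel measurable $g:\Omega\to\mathbb{R}$ such that for each unit vector $e$ and almost all lines $L$ parallel to $e$ (with respect to $(d-1)$-dimensional Lebesgue measure), the restriction of $g$ to any compact interval contained in $\Omega\cap L$ is absolutely continuous. $\mathrm{ACL}^1(\Omega)$: $g\in\mathrm{ACL}(\Omega)$ with $\partial_e g\in L^1(\Omega)$ for all unit vectors $e$. $\mathrm{ACL}^1_{\mathrm{loc}}(\Omega)$: $g$ such that each $x\in\Omega$ has an open neighbourhood $U\subseteq\Omega$ with $g|_U\in\mathrm{ACL}^1(U)$. *)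

theory Defs
  imports "HOL-Analysis.Analysis"
begin

section \<open>Directional derivatives, gradient, Hessian, divergence\<close>

definition dir_deriv :: "'a::real_normed_vector \<Rightarrow> ('a \<Rightarrow> real) \<Rightarrow> 'a \<Rightarrow> real" where
  "dir_deriv e g x = deriv (\<lambda>t. g (x + t *\<^sub>R e)) 0"

definition dir_differentiable :: "'a::real_normed_vector \<Rightarrow> ('a \<Rightarrow> real) \<Rightarrow> 'a \<Rightarrow> bool" where
  "dir_differentiable e g x \<longleftrightarrow> (\<lambda>t. g (x + t *\<^sub>R e)) differentiable (at 0)"

definition gradient :: "(real ^ 'n \<Rightarrow> real) \<Rightarrow> real ^ 'n \<Rightarrow> real ^ 'n" where
  "gradient g x = (\<chi> j. dir_deriv (axis j 1) g x)"

definition hessian :: "(real ^ 'n \<Rightarrow> real) \<Rightarrow> real ^ 'n \<Rightarrow> real ^ 'n ^ 'n" where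
  "hessian g x = (\<chi> j k. dir_deriv (axis j 1) (dir_deriv (axis k 1) g) x)"

definition divergence :: "(real ^ 'n \<Rightarrow> real ^ 'n) \<Rightarrow> real ^ 'n \<Rightarrow> real" where
  "divergence V x = (\<Sum>j\<in>UNIV. dir_deriv (axis j 1) (\<lambda>y. V y $ j) x)"

definition twice_cont_differentiable :: "(real ^ 'n \<Rightarrow> real) \<Rightarrow> bool" where
  "twice_cont_differentiable g \<longleftrightarrow>
     (\<exists>(G :: real ^ 'n \<Rightarrow> real ^ 'n) (H :: real ^ 'n \<Rightarrow> real ^ 'n ^ 'n).
        (\<forall>x. (g has_derivative (\<lambda>h. G x \<bullet> h)) (at x)) \<and>
        (\<forall>x. (G has_derivative (\<lambda>h. H x *v h)) (at x)) \<and>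
        continuous_on UNIV H)"

section \<open>Absolute continuity on lines\<close>

text \<open>A finite division consists of nonempty compact intervals with pairwise disjoint
  interiors, so this is the usual epsilon-delta definition.\<close>

definition abs_cont_on :: "real set \<Rightarrow> (real \<Rightarrow> real) \<Rightarrow> bool" where
  "abs_cont_on S f \<longleftrightarrow>
     (\<forall>\<epsilon>>0. \<exists>\<delta>>0. \<forall>\<D>. \<D> division_of \<Union>\<D> \<and> \<Union>\<D> \<subseteq> S \<and> (\<Sum>K\<in>\<D>. Sup K - Inf K) < \<delta> \<longrightarrow>
        (\<Sum>K\<in>\<D>. \<bar>f (Sup K) - f (Inf K)\<bar>) < \<epsilon>)"

definition perp_basis :: "'a::euclidean_space \<Rightarrow> 'a set" where
  "perp_basis e = (SOME B. pairwise orthogonal B \<and> (\<forall>b\<in>B. norm b = 1) \<and> span B = {x. x \<bullet> e = 0})"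

text \<open>Lebesgue measure (on Borel sets) of the hyperplane orthogonal to a unit vector \<open>e\<close>,
  as a measure on the ambient space concentrated on that hyperplane: the image of product Lebesgue
  measure under coordinates in an orthonormal basis. By rotation invariance the choice of basis is
  immaterial; in dimension one it is the point mass at the origin.\<close>

definition perp_lebesgue :: "'a::euclidean_space \<Rightarrow> 'a measure" where
  "perp_lebesgue e =
     distr (\<Pi>\<^sub>M b\<in>perp_basis e. (lborel :: real measure)) borel
       (\<lambda>c. \<Sum>b\<in>perp_basis e. c b *\<^sub>R b)"

text \<open>The lines parallel to \<open>e\<close> are indexed by their intersection point \<open>y\<close> with
  the hyperplane orthogonal to \<open>e\<close>.\<close>

definition ACL :: "'a::euclidean_space set \<Rightarrow> ('a \<Rightarrow> real) \<Rightarrow> bool" where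
  "ACL \<Omega> g \<longleftrightarrow>
     g \<in> borel_measurable (restrict_space borel \<Omega>) \<and>
     (\<forall>e. norm e = 1 \<longrightarrow>
        (AE y in perp_lebesgue e. \<forall>a b. a \<le> b \<and> (\<forall>t\<in>{a..b}. y + t *\<^sub>R e \<in> \<Omega>) \<longrightarrow>
           abs_cont_on {a..b} (\<lambda>t. g (y + t *\<^sub>R e))))"

text \<open>For \<open>g\<close> in \<open>ACL \<Omega>\<close> with \<open>\<Omega>\<close> open, the directional derivative exists
  almost everywhere on \<open>\<Omega>\<close>; the value of \<open>dir_deriv\<close> elsewhere does not matter.\<close>

definition ACL1 :: "'a::euclidean_space set \<Rightarrow> ('a \<Rightarrow> real) \<Rightarrow> bool" where
  "ACL1 \<Omega> g \<longleftrightarrow> ACL \<Omega> g \<and> (\<forall>e. norm e = 1 \<longrightarrow> set_integrable lebesgue \<Omega> (dir_deriv e g))"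

definition ACL1_loc :: "'a::euclidean_space set \<Rightarrow> ('a \<Rightarrow> real) \<Rightarrow> bool" where
  "ACL1_loc \<Omega> g \<longleftrightarrow> (\<forall>x\<in>\<Omega>. \<exists>U. open U \<and> x \<in> U \<and> U \<subseteq> \<Omega> \<and> ACL1 U g)"

section \<open>Densities, marginals and Stein kernels\<close>

definition is_pdf :: "('a::euclidean_space \<Rightarrow> real) \<Rightarrow> bool" where
  "is_pdf p \<longleftrightarrow> (\<forall>x. 0 \<le> p x) \<and> has_bochner_integral lborel p 1"

definition pdf_mean :: "('a::euclidean_space \<Rightarrow> real) \<Rightarrow> 'a" where
  "pdf_mean p = (LINT x|lborel. p x *\<^sub>R x)"

text \<open>If there is only one coordinate, the integral below is over the one-point space, so the
  marginal is the density itself.\<close>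

definition marginal :: "(real ^ 'n \<Rightarrow> real) \<Rightarrow> 'n \<Rightarrow> real \<Rightarrow> real" where
  "marginal p i u =
     (LINT y|(\<Pi>\<^sub>M j\<in>UNIV - {i}. (lborel :: real measure)). p (\<chi> j. if j = i then u else y j))"

definition score :: "(real \<Rightarrow> real) \<Rightarrow> real \<Rightarrow> real" where
  "score q u = deriv q u / q u"

definition stein_kernel_1d :: "(real \<Rightarrow> real) \<Rightarrow> real \<Rightarrow> real" where
  "stein_kernel_1d q u = 1 / q u * (LINT v:{..u}|lborel. (pdf_mean q - v) * q v)"

definition stein_kernel :: "(real ^ 'n \<Rightarrow> real) \<Rightarrow> 'n \<Rightarrow> (real ^ 'n \<Rightarrow> real ^ 'n) \<Rightarrow> bool" where
  "stein_kernel p i \<tau> \<longleftrightarrow>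
     is_pdf p \<and> integrable lborel (\<lambda>x. p x *\<^sub>R x) \<and> open {x. 0 < p x} \<and>
     (\<forall>j. ACL1_loc {x. 0 < p x} (\<lambda>x. \<tau> x $ j * p x)) \<and>
     (AE x in lebesgue. 0 < p x \<longrightarrow>
        1 / p x * divergence (\<lambda>y. p y *\<^sub>R \<tau> y) x = pdf_mean p $ i - x $ i)"

text \<open>The equation is required pointwise, including existence of the partial derivatives
  entering the divergence.\<close>

definition solves_score_equation ::
    "(real ^ 'n \<Rightarrow> real) \<Rightarrow> 'n \<Rightarrow> (real ^ 'n \<Rightarrow> real ^ 'n) \<Rightarrow> bool" where
  "solves_score_equation p i \<kappa> \<longleftrightarrow>
     (\<forall>x. (\<forall>j. dir_differentiable (axis j 1) (\<lambda>y. (p y *\<^sub>R \<kappa> y) $ j) x) \<and>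
          1 / p x * divergence (\<lambda>y. p y *\<^sub>R \<kappa> y) x = score (marginal p i) (x $ i))"

end

theory Submission
  imports Defs
begin

text \<open>
  Write \<open>q\<close> for the marginal, \<open>\<rho> = q'/q\<close> for its score and \<open>T\<close> for its Stein kernel. No decay is imposed on
  \<open>\<kappa>\<close>, so the equation \<open>\<Sum>j\<noteq>i. \<partial>\<^sub>j (\<kappa>\<^sub>j p) = \<rho>(x\<^sub>i) p - \<partial>\<^sub>i p\<close> can be solved with a single
  nonzero component besides the \<open>i\<close>-th: for some \<open>j \<noteq> i\<close> put \<open>\<kappa>\<^sub>j p = \<rho>(x\<^sub>i) A - B\<close>, where \<open>A\<close> and \<open>B\<close> are
  the primitives of \<open>p\<close> and \<open>\<partial>\<^sub>i p\<close> in the variable \<open>x\<^sub>j\<close> that vanish for \<open>x\<^sub>j = 0\<close>. In dimension one,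
  \<open>q = p\<close> and the right-hand side vanishes. The Stein equation follows from \<open>T' + \<rho> T = \<nu>\<^sub>i - x\<^sub>i\<close>.

  The only factor that need not be continuously differentiable is \<open>q'(x\<^sub>i)\<close>. By the integrability
  assumptions and Fubini, \<open>q'\<close> is continuous and is the primitive of the integrable function
  obtained by integrating \<open>\<partial>\<^sub>i\<^sub>i p\<close> over the other coordinates. Hence it is absolutely continuous and
  almost everywhere differentiable, which gives the required regularity.
\<close>

subsection \<open>Absolutely continuous functions on the real line\<close>

lemma has_real_derivative_if_increment_eq_integral:
  fixes F f :: "real \<Rightarrow> real"
  assumes inc: "\<And>a b. a \<le> b \<Longrightarrow> F b - F a = integral {a..b} f"
    and cont: "continuous_on UNIV f"
  shows "(F has_real_derivative f u) (at u)"
proof -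
  \<comment> \<open>Starting the integral at \<open>u - 1\<close> keeps \<open>u\<close> in the
    interior of the interval, so the derivative obtained is two-sided.\<close>
  have "((\<lambda>x. F (u - 1) + integral {u - 1..x} f) has_real_derivative f u) (at u within {u - 1..u + 1})"
    using integral_has_real_derivative[OF continuous_on_subset[OF cont], of "u - 1" "u + 1" u]
    by (auto intro!: derivative_eq_intros)
  then have "((\<lambda>x. F (u - 1) + integral {u - 1..x} f) has_real_derivative f u) (at u)"
    by (subst (asm) at_within_Icc_at) auto
  moreover have "eventually (\<lambda>x. F (u - 1) + integral {u - 1..x} f = F x) (nhds u)"
    using eventually_nhds_in_open[of "{u - 1<..}" u]
    by (auto elim!: eventually_mono simp: inc[symmetric])
  ultimately show ?thesis
    by (subst (asm) DERIV_cong_ev) (auto)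
qed

text \<open>This is Lebesgue differentiation: off a negligible set the averages of \<open>f\<close>
  over \<open>[x, x + h]\<close> tend to \<open>f x\<close>, and these averages are the right
  difference quotients of \<open>F\<close>.\<close>

lemma AE_right_derivative_if_increment_eq_integral:
  fixes F f :: "real \<Rightarrow> real"
  assumes int: "integrable lborel f"
    and inc: "\<And>a b. a \<le> b \<Longrightarrow> F b - F a = integral {a..b} f"
  shows "AE u in lborel. ((\<lambda>h. (F (u + h) - F u) / h) \<longlongrightarrow> f u) (at_right 0)"
proof -
  have "f integrable_on cbox a b" for a b
    using integrable_on_lborel[OF int] by (meson integrable_on_subcbox subset_UNIV)
  from integrable_ccontinuous_explicit[OF this] obtain N where N: "negligible N"
    and lim: "\<And>x e. \<lbrakk>x \<notin> N; 0 < e\<rbrakk> \<Longrightarrow> \<exists>d>0. \<forall>h. 0 < h \<and> h < d \<longrightarrow>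
       norm (integral (cbox x (x + h *\<^sub>R One)) f /\<^sub>R h ^ DIM(real) - f x) < e"
    by blast
  have "((\<lambda>h. (F (x + h) - F x) / h) \<longlongrightarrow> f x) (at_right 0)" if "x \<notin> N" for x
  proof (rule tendstoI)
    fix e :: real assume "e > 0"
    from lim[OF that this] obtain d where "d > 0" and
      d: "\<And>h. 0 < h \<Longrightarrow> h < d \<Longrightarrow> norm (integral (cbox x (x + h *\<^sub>R One)) f /\<^sub>R h ^ DIM(real) - f x) < e"
      by blast
    show "\<forall>\<^sub>F h in at_right 0. dist ((F (x + h) - F x) / h) (f x) < e"
      unfolding eventually_at_right_field
      using \<open>d > 0\<close> d by (intro exI[of _ d]) (auto simp: inc dist_norm divide_inverse mult.commute)
  qed
  moreover have "AE x in lebesgue. x \<notin> N"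
    using N by (simp add: AE_not_in negligible_iff_null_sets)
  ultimately show ?thesis
    unfolding AE_completion_iff by (auto elim!: eventually_mono)
qed

text \<open>Left difference quotients of \<open>F\<close> are right difference quotients of the
  reflected function \<open>- F (- x)\<close>, so the one-sided result is applied twice.\<close>

lemma AE_derivative_if_increment_eq_integral:
  fixes F f :: "real \<Rightarrow> real"
  assumes int: "integrable lborel f"
    and inc: "\<And>a b. a \<le> b \<Longrightarrow> F b - F a = integral {a..b} f"
  shows "AE u in lborel. (F has_real_derivative f u) (at u)"
proof -
  let ?G = "\<lambda>x. - F (- x)"
  have "AE u in lborel. ((\<lambda>h. (?G (u + h) - ?G u) / h) \<longlongrightarrow> f (- u)) (at_right 0)"
  proof (rule AE_right_derivative_if_increment_eq_integral)
    show "integrable lborel (\<lambda>x. f (- x))"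
      using lborel_integrable_real_affine[OF int, of "-1" 0] by simp
    show "?G b - ?G a = integral {a..b} (\<lambda>x. f (- x))" if "a \<le> b" for a b
      using inc[of "- b" "- a"] that Henstock_Kurzweil_Integration.integral_reflect_real[of "- a" "- b" f] by simp
  qed
  \<comment> \<open>Lebesgue measure is invariant under negation, so the exceptional set may be
    reflected back.\<close>
  then have "AE u in distr lborel borel uminus. ((\<lambda>h. (?G (u + h) - ?G u) / h) \<longlongrightarrow> f (- u)) (at_right 0)"
    unfolding lborel_distr_uminus .
  from AE_distrD[OF _ this]
  have left: "AE u in lborel. ((\<lambda>h. (?G (- u + h) - ?G (- u)) / h) \<longlongrightarrow> f u) (at_right 0)"
    by simp
  have "AE u in lborel. ((\<lambda>h. (F (u + h) - F u) / h) \<longlongrightarrow> f u) (at_right 0)"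
    by (rule AE_right_derivative_if_increment_eq_integral[OF int inc])
  with left show ?thesis
  proof eventually_elim
    case (elim u)
    have "((\<lambda>h. (F (u + h) - F u) / h) \<longlongrightarrow> f u) (at_left 0)"
      unfolding filterlim_at_left_to_right
      using elim(1) by (simp add: minus_divide_left)
    with elim(2) show ?case
      by (simp add: DERIV_def filterlim_split_at)
  qed
qed

text \<open>Absolute continuity of the integral, by truncation. Replacing \<open>w\<close> by
  \<open>min w n\<close> costs less than half of \<epsilon> in total, and the truncated function
  contributes at most \<open>n\<close> times the total length of the division.\<close>

lemma small_integral_if_small_measure:
  fixes w :: "real \<Rightarrow> real"
  assumes w: "w integrable_on {a..b}" and nonneg: "\<And>x. x \<in> {a..b} \<Longrightarrow> 0 \<le> w x" and "\<epsilon> > 0"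
  shows "\<exists>\<delta>>0. \<forall>\<D>. \<D> division_of \<Union>\<D> \<and> \<Union>\<D> \<subseteq> {a..b} \<and> (\<Sum>K\<in>\<D>. Sup K - Inf K) < \<delta> \<longrightarrow>
           (\<Sum>K\<in>\<D>. integral K w) < \<epsilon>"
proof -
  let ?h = "\<lambda>n x. min (w x) (real n)"
  have abs: "w absolutely_integrable_on {a..b}"
    using w nonneg by (intro nonnegative_absolutely_integrable_1) auto
  have minint: "?h n integrable_on {a..b}" for n
    by (intro set_lebesgue_integral_eq_integral(1) absolutely_integrable_min_1 abs) auto
  have "(\<lambda>n. integral {a..b} (?h n)) \<longlonglongrightarrow> integral {a..b} w"
  proof (rule dominated_convergence(2))
    show "?h n integrable_on {a..b}" for n by (rule minint)
    show "w integrable_on {a..b}" by fact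
    show "norm (?h n x) \<le> w x" if "x \<in> {a..b}" for n x
      using nonneg[OF that] by auto
    show "(\<lambda>n. ?h n x) \<longlonglongrightarrow> w x" if "x \<in> {a..b}" for x
    proof (rule tendsto_eventually)
      obtain N where "w x \<le> real N" using real_arch_simple by blast
      then show "\<forall>\<^sub>F n in sequentially. ?h n x = w x"
        unfolding eventually_sequentially by (intro exI[of _ N]) (auto simp: min_def)
    qed
  qed
  from order_tendstoD(1)[OF this, of "integral {a..b} w - \<epsilon> / 2"] \<open>\<epsilon> > 0\<close>
  obtain n where n: "integral {a..b} w - \<epsilon> / 2 < integral {a..b} (?h n)"
    by (auto simp: eventually_sequentially)
  let ?r = "\<lambda>x. w x - ?h n x"
  have r: "?r integrable_on {a..b}" using w minint by (rule integrable_diff)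
  have small: "integral {a..b} ?r < \<epsilon> / 2"
    using n by (subst integral_diff[OF w minint]) simp
  \<comment> \<open>With this \<delta> the truncated part is at most half of \<epsilon>;
    \<open>n + 1\<close> keeps the quotient meaningful for \<open>n = 0\<close>.\<close>
  show ?thesis
  proof (intro exI[of _ "\<epsilon> / (2 * (real n + 1))"] conjI allI impI)
    fix \<D> :: "real set set"
    assume "\<D> division_of \<Union>\<D> \<and> \<Union>\<D> \<subseteq> {a..b} \<and> (\<Sum>K\<in>\<D>. Sup K - Inf K) < \<epsilon> / (2 * (real n + 1))"
    then have div: "\<D> division_of \<Union>\<D>" and sub: "\<Union>\<D> \<subseteq> {a..b}"
      and len: "(\<Sum>K\<in>\<D>. Sup K - Inf K) < \<epsilon> / (2 * (real n + 1))" by auto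
    have K: "\<exists>c d. K = {c..d} \<and> c \<le> d" "K \<subseteq> {a..b}" if "K \<in> \<D>" for K
      using division_ofD(3,4)[OF div that] sub that by fastforce+
    have rK: "?r integrable_on K" if "K \<in> \<D>" for K
      using K[OF that] by (auto intro: integrable_on_subinterval[OF r])
    have "(\<Sum>K\<in>\<D>. integral K w) \<le> (\<Sum>K\<in>\<D>. integral K ?r + real n * (Sup K - Inf K))"
    proof (rule sum_mono)
      fix K assume "K \<in> \<D>"
      from K[OF this] obtain c d where [simp]: "K = {c..d}" "c \<le> d" and "{c..d} \<subseteq> {a..b}" by blast
      then have i: "?r integrable_on {c..d}" "?h n integrable_on {c..d}"
        by (auto intro: integrable_on_subinterval[OF r] integrable_on_subinterval[OF minint])
      have "integral {c..d} w = integral {c..d} ?r + integral {c..d} (?h n)"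
        by (subst integral_add[symmetric, OF i]) simp
      also have "integral {c..d} (?h n) \<le> integral {c..d} (\<lambda>x. real n)"
        using i(2) by (intro integral_le) auto
      finally show "integral K w \<le> integral K ?r + real n * (Sup K - Inf K)"
        by (simp add: algebra_simps)
    qed
    also have "\<dots> = (\<Sum>K\<in>\<D>. integral K ?r) + real n * (\<Sum>K\<in>\<D>. Sup K - Inf K)"
      by (simp add: sum.distrib sum_distrib_left)
    also have "(\<Sum>K\<in>\<D>. integral K ?r) = integral (\<Union>\<D>) ?r"
      using integral_combine_division_bottomup[OF div rK] by simp
    also have "integral (\<Union>\<D>) ?r \<le> integral {a..b} ?r"
    proof (rule integral_subset_le[OF sub _ r])
      show "?r integrable_on \<Union>\<D>"
        using integrable_combine_division[OF div rK] .
    qed auto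
    also note small
    also have "real n * (\<Sum>K\<in>\<D>. Sup K - Inf K) \<le> real n * (\<epsilon> / (2 * (real n + 1)))"
      using len by (intro mult_left_mono) auto
    also have "\<dots> \<le> \<epsilon> / 2"
      using \<open>\<epsilon> > 0\<close> by (simp add: field_simps)
    finally show "(\<Sum>K\<in>\<D>. integral K w) < \<epsilon>" by simp
  qed (use \<open>\<epsilon> > 0\<close> in auto)
qed

text \<open>An inequality for the increments, rather than an identity, lets a single majorant
  \<open>w\<close> treat a sum of products whose factors have different regularity.\<close>

lemma abs_cont_on_if_increment_le_integral:
  fixes F w :: "real \<Rightarrow> real"
  assumes w: "w integrable_on {a..b}" and nonneg: "\<And>x. x \<in> {a..b} \<Longrightarrow> 0 \<le> w x"
    and le: "\<And>s t. a \<le> s \<Longrightarrow> s \<le> t \<Longrightarrow> t \<le> b \<Longrightarrow> \<bar>F t - F s\<bar> \<le> integral {s..t} w"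
  shows "abs_cont_on {a..b} F"
  unfolding abs_cont_on_def
proof (intro allI impI)
  fix \<epsilon> :: real assume "\<epsilon> > 0"
  from small_integral_if_small_measure[OF w nonneg this]
  obtain \<delta> where "\<delta> > 0" and \<delta>: "\<And>\<D>. \<D> division_of \<Union>\<D> \<and> \<Union>\<D> \<subseteq> {a..b} \<and>
      (\<Sum>K\<in>\<D>. Sup K - Inf K) < \<delta> \<Longrightarrow> (\<Sum>K\<in>\<D>. integral K w) < \<epsilon>"
    by blast
  show "\<exists>\<delta>>0. \<forall>\<D>. \<D> division_of \<Union>\<D> \<and> \<Union>\<D> \<subseteq> {a..b} \<and> (\<Sum>K\<in>\<D>. Sup K - Inf K) < \<delta> \<longrightarrow>
        (\<Sum>K\<in>\<D>. \<bar>F (Sup K) - F (Inf K)\<bar>) < \<epsilon>"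
  proof (intro exI[of _ \<delta>] conjI allI impI)
    fix \<D> :: "real set set"
    assume D: "\<D> division_of \<Union>\<D> \<and> \<Union>\<D> \<subseteq> {a..b} \<and> (\<Sum>K\<in>\<D>. Sup K - Inf K) < \<delta>"
    have "(\<Sum>K\<in>\<D>. \<bar>F (Sup K) - F (Inf K)\<bar>) \<le> (\<Sum>K\<in>\<D>. integral K w)"
    proof (rule sum_mono)
      fix K assume "K \<in> \<D>"
      with D obtain c d where [simp]: "K = {c..d}" "c \<le> d"
        by (metis atLeastatMost_empty_iff2 box_real(2) division_ofD(3,4))
      have "{c..d} \<subseteq> {a..b}" using D \<open>K \<in> \<D>\<close> unfolding \<open>K = {c..d}\<close> by blast
      then show "\<bar>F (Sup K) - F (Inf K)\<bar> \<le> integral K w"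
        by (auto intro!: le)
    qed
    with \<delta>[OF D] show "(\<Sum>K\<in>\<D>. \<bar>F (Sup K) - F (Inf K)\<bar>) < \<epsilon>" by simp
  qed fact
qed

subsection \<open>Continuously differentiable functions and their primitives along a coordinate\<close>

text \<open>The derivative is valued in the Banach space of bounded linear maps, so that its
  continuity can be stated and it can be integrated in the Leibniz rule.\<close>

definition C1 :: "('a::euclidean_space \<Rightarrow> real) \<Rightarrow> ('a \<Rightarrow> 'a \<Rightarrow>\<^sub>L real) \<Rightarrow> bool" where
  "C1 f f' \<longleftrightarrow> (\<forall>x. (f has_derivative f' x) (at x)) \<and> continuous_on UNIV f'"

lemma C1_has_derivative: "C1 f f' \<Longrightarrow> (f has_derivative f' x) (at x)"
  by (simp add: C1_def)

lemma C1_continuous_deriv: "C1 f f' \<Longrightarrow> continuous_on S f'"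
  using continuous_on_subset by (auto simp: C1_def)

lemma C1_continuous: "C1 f f' \<Longrightarrow> continuous_on S f"
  using C1_has_derivative has_derivative_continuous
  by (metis continuous_at_imp_continuous_on)

lemma C1_const: "C1 (\<lambda>x. c) (\<lambda>x. 0)"
  by (auto simp: C1_def zero_blinfun.rep_eq)

lemma C1_mult:
  assumes "C1 f f'" "C1 g g'"
  shows "C1 (\<lambda>x. f x * g x) (\<lambda>x. f x *\<^sub>R g' x + g x *\<^sub>R f' x)"
  using assms C1_continuous[OF assms(1)] C1_continuous[OF assms(2)] unfolding C1_def
  by (auto intro!: continuous_intros derivative_eq_intros
      simp: blinfun.add_left blinfun.scaleR_left)

lemma C1_inner: "C1 (\<lambda>x. x \<bullet> b) (\<lambda>x. blinfun_inner_left b)"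
  by (auto simp: C1_def intro!: derivative_eq_intros)

lemma C1_compose:
  fixes h h' :: "real \<Rightarrow> real"
  assumes h: "\<And>u. (h has_real_derivative h' u) (at u)" and h': "continuous_on UNIV h'"
    and f: "C1 f f'"
  shows "C1 (\<lambda>x. h (f x)) (\<lambda>x. h' (f x) *\<^sub>R f' x)"
  unfolding C1_def
proof (intro conjI allI)
  fix x show "((\<lambda>x. h (f x)) has_derivative (h' (f x) *\<^sub>R f' x)) (at x)"
    using has_derivative_compose[OF C1_has_derivative[OF f, of x] h[unfolded has_field_derivative_def, of "f x"]]
    by (rule has_derivative_eq_rhs) (auto simp: blinfun.scaleR_left)
  show "continuous_on UNIV (\<lambda>x. h' (f x) *\<^sub>R f' x)"
    by (intro continuous_intros C1_continuous_deriv[OF f] continuous_on_compose2[OF h' C1_continuous[OF f]]) auto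
qed

lemma C1_component:
  fixes h h' :: "real \<Rightarrow> real"
  assumes "\<And>u. (h has_real_derivative h' u) (at u)" and "continuous_on UNIV h'"
  shows "C1 (\<lambda>x. h (x $ i)) (\<lambda>x. h' (x $ i) *\<^sub>R blinfun_inner_left (axis i 1))"
  using C1_compose[OF assms C1_inner[of "axis i (1::real)"]] by (simp flip: cart_eq_inner_axis)

lemma C1_line:
  assumes "C1 f f'"
  shows "((\<lambda>t. f (x + t *\<^sub>R e)) has_real_derivative f' (x + s *\<^sub>R e) e) (at s)"
proof -
  have "((\<lambda>t. x + t *\<^sub>R e) has_derivative (\<lambda>t. t *\<^sub>R e)) (at s)"
    by (auto intro!: derivative_eq_intros)
  from has_derivative_compose[OF this C1_has_derivative[OF assms]]
  show ?thesis
    by (simp add: has_field_derivative_def blinfun.scaleR_right mult_commute_abs)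
qed

text \<open>
  For a basis vector \<open>b\<close>, the function \<open>A\<close> below is the integral of \<open>f\<close> in direction \<open>b\<close> from the
  hyperplane \<open>x \<bullet> b = 0\<close> to \<open>x\<close>, rescaled to \<open>[0, 1]\<close> so that the Leibniz rule applies.
\<close>

lemma C1_line_integral:
  fixes f :: "'a::euclidean_space \<Rightarrow> real"
  assumes f: "C1 f f'" and b: "norm b = 1"
  defines "A \<equiv> \<lambda>x. integral {0..1} (\<lambda>s. (x \<bullet> b) * f (x + ((s - 1) * (x \<bullet> b)) *\<^sub>R b))"
  shows "\<exists>A'. C1 A A' \<and> (\<forall>x. A' x b = f x)"
proof -
  let ?z = "\<lambda>x (s::real). x + ((s - 1) * (x \<bullet> b)) *\<^sub>R b"
  \<comment> \<open>\<open>L s\<close> is the derivative of \<open>?z\<close> in \<open>x\<close>,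
    and \<open>D x s\<close> below is that of the integrand of \<open>A\<close>.\<close>
  define L where "L = (\<lambda>s. id_blinfun + (s - 1) *\<^sub>R (blinfun_scaleR_left b o\<^sub>L blinfun_inner_left b))"
  have L: "L s h = h + ((s - 1) * (h \<bullet> b)) *\<^sub>R b" for s h
    by (simp add: L_def blinfun.add_left blinfun.scaleR_left)
  have cL: "continuous_on S (\<lambda>p. L (snd p))" for S :: "('a \<times> real) set"
    unfolding L_def by (intro continuous_intros)
  define D where "D = (\<lambda>x s. (x \<bullet> b) *\<^sub>R (f' (?z x s) o\<^sub>L L s) + f (?z x s) *\<^sub>R blinfun_inner_left b)"
  have der: "((\<lambda>x. (x \<bullet> b) * f (?z x s)) has_derivative blinfun_apply (D x s)) (at x within UNIV)" for x s
  proof -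
    have "((\<lambda>x. ?z x s) has_derivative L s) (at x)"
      by (auto intro!: derivative_eq_intros simp: L)
    from has_derivative_compose[OF this C1_has_derivative[OF f]]
    have "((\<lambda>x. f (?z x s)) has_derivative (f' (?z x s) o\<^sub>L L s)) (at x)"
      by (simp add: o_def blinfun_compose.rep_eq)
    then show ?thesis
      unfolding D_def
      by (auto intro!: derivative_eq_intros simp: blinfun.add_left blinfun.scaleR_left)
  qed
  have cz: "continuous_on S (\<lambda>p. ?z (fst p) (snd p))" for S
    by (intro continuous_intros)
  have cD: "continuous_on (UNIV \<times> cbox 0 1) (\<lambda>(x, s). D x s)"
    unfolding D_def case_prod_beta
    by (intro continuous_intros bounded_bilinear.continuous_on[OF bounded_bilinear_blinfun_compose]
        continuous_on_compose2[OF C1_continuous_deriv[OF f, of UNIV] cz] cL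
        continuous_on_compose2[OF C1_continuous[OF f, of UNIV] cz]) auto
  have cf: "continuous_on {0..1} (\<lambda>s. (x \<bullet> b) * f (?z x s))" for x
    by (intro continuous_intros continuous_on_compose2[OF C1_continuous[OF f, of UNIV]]) auto
  have cDx: "D x integrable_on {0..1}" for x
  proof -
    have "continuous_on {0..1} (\<lambda>s. (\<lambda>(x, s). D x s) (x, s))"
      by (rule continuous_on_compose2[OF cD]) (auto intro!: continuous_intros)
    then show ?thesis
      using integrable_continuous_real[of 0 1 "D x"] by simp
  qed
  show ?thesis
  proof (intro exI conjI allI)
    show "C1 A (\<lambda>x. integral {0..1} (D x))"
      unfolding C1_def
    proof (intro conjI allI)
      fix x
      show "(A has_derivative integral {0..1} (D x)) (at x)"
        using leibniz_rule[OF der _ cD, of x] integrable_continuous_real[OF cf]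
        unfolding A_def by simp
      show "continuous_on UNIV (\<lambda>x. integral {0..1} (D x))"
        using integral_continuous_on_param[OF cD] by simp
    qed
    fix x
    \<comment> \<open>In direction \<open>b\<close> the differentiated integrand is the derivative
      in \<open>s\<close> of \<open>s * f (?z x s)\<close>. It therefore integrates to the value at
      \<open>s = 1\<close>, which is \<open>f x\<close> because \<open>?z x 1 = x\<close>.\<close>
    have "((\<lambda>s. D x s b) has_integral (1 * f (?z x 1) - 0 * f (?z x 0))) {0..1}"
    proof (rule fundamental_theorem_of_calculus)
      fix s :: real
      have "((\<lambda>s. s * f (?z x s)) has_real_derivative D x s b) (at s within {0..1})"
      proof -
        have z: "?z x s = (x - (x \<bullet> b) *\<^sub>R b) + s *\<^sub>R ((x \<bullet> b) *\<^sub>R b)" for s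
          by (simp add: algebra_simps)
        have "((\<lambda>s. f (?z x s)) has_real_derivative f' (?z x s) ((x \<bullet> b) *\<^sub>R b)) (at s)"
          unfolding z by (rule C1_line[OF f])
        then have "((\<lambda>s. s * f (?z x s)) has_real_derivative f (?z x s) + f' (?z x s) ((x \<bullet> b) *\<^sub>R b) * s) (at s)"
          by (auto intro!: derivative_eq_intros)
        moreover have "D x s b = f (?z x s) + f' (?z x s) ((x \<bullet> b) *\<^sub>R b) * s"
        proof -
          have "b + (s - 1) *\<^sub>R b = s *\<^sub>R b" by (simp add: algebra_simps)
          then show ?thesis
            using b by (simp add: D_def L norm_eq_1 blinfun.add_left blinfun.scaleR_left
                blinfun.scaleR_right)
        qed
        ultimately show ?thesis
          by (auto intro: has_field_derivative_at_within)
      qed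
      then show "((\<lambda>s. s * f (?z x s)) has_vector_derivative D x s b) (at s within {0..1})"
        by (simp add: has_real_derivative_iff_has_vector_derivative)
    qed simp
    then have "integral {0..1} (\<lambda>s. D x s b) = f x"
      by (simp add: integral_unique)
    then show "blinfun_apply (integral {0..1} (D x)) b = f x"
      by (simp add: blinfun_apply_integral[OF cDx])
  qed
qed

subsection \<open>Slicing Lebesgue measure along a coordinate\<close>

lemma Basis_vec_real: "(Basis :: (real ^ 'n) set) = range (\<lambda>j. axis j 1)"
  by (auto simp: Basis_vec_def)

lemma prod_Basis_vec_real:
  fixes g :: "real ^ 'n \<Rightarrow> 'b::comm_monoid_mult"
  shows "(\<Prod>b\<in>Basis. g b) = (\<Prod>j\<in>UNIV. g (axis j 1))"
  unfolding Basis_vec_real by (subst prod.reindex) (auto simp: inj_on_def axis_eq_axis)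

definition slice :: "'n \<Rightarrow> real \<Rightarrow> ('n \<Rightarrow> real) \<Rightarrow> real ^ 'n" where
  "slice i u y = (\<chi> j. if j = i then u else y j)"

lemma slice_nth: "slice i u y $ j = (if j = i then u else y j)"
  by (simp add: slice_def)

lemma slice_shift: "slice i 0 y + u *\<^sub>R axis i 1 = slice i u y"
  by (simp add: vec_eq_iff slice_nth axis_def)

lemma measurable_slice[measurable]:
  "(\<lambda>(u, y). slice i u y) \<in> lborel \<Otimes>\<^sub>M (\<Pi>\<^sub>M j\<in>UNIV - {i}. lborel) \<rightarrow>\<^sub>M borel"
proof (subst borel_measurable_euclidean_space, rule ballI)
  fix b :: "real ^ 'a" assume "b \<in> Basis"
  then obtain j where [simp]: "b = axis j 1" by (auto simp: Basis_vec_real)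
  show "(\<lambda>x. (case x of (u, y) \<Rightarrow> slice i u y) \<bullet> b)
    \<in> borel_measurable (lborel \<Otimes>\<^sub>M (\<Pi>\<^sub>M j\<in>UNIV - {i}. lborel))"
    by (cases "j = i") (auto simp: case_prod_beta inner_axis slice_nth)
qed

text \<open>Lebesgue measure is determined by open boxes, and the preimage of a box is an interval
  times a box in the other coordinates. Fubini thus becomes available with the \<open>i\<close>-th
  coordinate singled out. In dimension one the second factor is a unit point mass.\<close>

lemma distr_slice:
  "distr (lborel \<Otimes>\<^sub>M (\<Pi>\<^sub>M j\<in>UNIV - {i}. lborel)) borel (\<lambda>(u, y). slice i u y) = lborel"
proof (rule lborel_eqI[symmetric])
  interpret product_sigma_finite "\<lambda>_. lborel :: real measure" ..
  interpret finite_product_sigma_finite "\<lambda>_. lborel :: real measure" "UNIV - {i}"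
    by standard auto
  fix l u :: "real ^ 'a" assume le: "\<And>b. b \<in> Basis \<Longrightarrow> l \<bullet> b \<le> u \<bullet> b"
  have le': "l $ j \<le> u $ j" for j
    using le[of "axis j 1"] by (simp add: Basis_vec_real inner_axis)
  let ?M = "\<Pi>\<^sub>M j\<in>UNIV - {i}. lborel :: real measure"
  have "(\<lambda>(u, y). slice i u y) -` box l u \<inter> space (lborel \<Otimes>\<^sub>M ?M) =
      {l $ i <..< u $ i} \<times> (\<Pi>\<^sub>E j\<in>UNIV - {i}. {l $ j <..< u $ j})"
  proof (intro set_eqI)
    fix z :: "real \<times> ('a \<Rightarrow> real)"
    obtain v y where z: "z = (v, y)" by (cases z)
    have "(\<forall>j. l $ j < slice i v y $ j \<and> slice i v y $ j < u $ j) \<longleftrightarrow>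
        (l $ i < v \<and> v < u $ i) \<and> (\<forall>j\<in>UNIV - {i}. l $ j < y j \<and> y j < u $ j)"
      by (auto simp: slice_nth)
    then show "z \<in> (\<lambda>(u, y). slice i u y) -` box l u \<inter> space (lborel \<Otimes>\<^sub>M ?M) \<longleftrightarrow>
      z \<in> {l $ i <..< u $ i} \<times> (\<Pi>\<^sub>E j\<in>UNIV - {i}. {l $ j <..< u $ j})"
      unfolding z by (simp add: mem_box_cart space_pair_measure space_PiM PiE_iff)
  qed
  then have "emeasure (distr (lborel \<Otimes>\<^sub>M ?M) borel (\<lambda>(u, y). slice i u y)) (box l u) =
      emeasure (lborel \<Otimes>\<^sub>M ?M) ({l $ i <..< u $ i} \<times> (\<Pi>\<^sub>E j\<in>UNIV - {i}. {l $ j <..< u $ j}))"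
    by (subst emeasure_distr) auto
  also have "\<dots> = emeasure lborel {l $ i <..< u $ i} * (\<Prod>j\<in>UNIV - {i}. emeasure lborel {l $ j <..< u $ j})"
    by (subst emeasure_pair_measure_Times) (auto simp: emeasure_PiM)
  also have "\<dots> = (\<Prod>j\<in>UNIV. ennreal (u $ j - l $ j))"
    using le' by (subst prod.remove[of _ i]) auto
  also have "\<dots> = ennreal (\<Prod>b\<in>Basis. (u - l) \<bullet> b)"
    using le' by (subst prod_ennreal) (auto simp: prod_Basis_vec_real inner_axis)
  finally show "emeasure (distr (lborel \<Otimes>\<^sub>M ?M) borel (\<lambda>(u, y). slice i u y)) (box l u) =
     ennreal (\<Prod>b\<in>Basis. (u - l) \<bullet> b)" .
qed auto

lemma integrable_slice_iff:
  fixes f :: "real ^ 'n \<Rightarrow> real"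
  assumes "f \<in> borel_measurable borel"
  shows "integrable (lborel \<Otimes>\<^sub>M (\<Pi>\<^sub>M j\<in>UNIV - {i}. lborel)) (\<lambda>(u, y). f (slice i u y)) \<longleftrightarrow> integrable lborel f"
  using assms by (subst distr_slice[symmetric, of i], subst integrable_distr_eq) (auto simp: case_prod_beta')

lemma integral_slice:
  fixes f :: "real ^ 'n \<Rightarrow> real"
  assumes "f \<in> borel_measurable borel"
  shows "integral\<^sup>L (lborel \<Otimes>\<^sub>M (\<Pi>\<^sub>M j\<in>UNIV - {i}. lborel)) (\<lambda>(u, y). f (slice i u y)) = integral\<^sup>L lborel f"
proof -
  have "integral\<^sup>L lborel f =
      integral\<^sup>L (distr (lborel \<Otimes>\<^sub>M (\<Pi>\<^sub>M j\<in>UNIV - {i}. lborel)) borel (\<lambda>(u, y). slice i u y)) f"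
    by (simp only: distr_slice)
  also have "\<dots> = integral\<^sup>L (lborel \<Otimes>\<^sub>M (\<Pi>\<^sub>M j\<in>UNIV - {i}. lborel)) (\<lambda>(u, y). f (slice i u y))"
    by (subst integral_distr[OF measurable_slice assms]) (simp add: case_prod_beta')
  finally show ?thesis ..
qed

lemma sigma_finite_PiM_lborel:
  "finite I \<Longrightarrow> sigma_finite_measure (\<Pi>\<^sub>M j\<in>I. lborel :: real measure)"
  by (intro product_sigma_finite.sigma_finite) (unfold_locales)

text \<open>A null set of the line times all values of the other coordinates is null in the product,
  so the cylinder over an exceptional set is null.\<close>

lemma AE_component:
  fixes P :: "real \<Rightarrow> bool"
  assumes "AE u in lborel. P u"
  shows "AE x in (lborel :: (real ^ 'n) measure). P (x $ i)"
proof -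
  let ?M = "\<Pi>\<^sub>M j\<in>UNIV - {i}. lborel :: real measure"
  obtain N where N: "\<And>u. u \<in> space lborel - N \<Longrightarrow> P u" "N \<in> null_sets lborel"
    using AE_E3[OF assms] by blast
  have "N \<times> space ?M \<in> null_sets (lborel \<Otimes>\<^sub>M ?M)"
    using N(2) by (intro sigma_finite_measure.times_in_null_sets1[OF sigma_finite_PiM_lborel]) auto
  from AE_not_in[OF this] have "AE z in lborel \<Otimes>\<^sub>M ?M. slice i (fst z) (snd z) $ i \<notin> N"
    using AE_space by eventually_elim (auto simp: slice_nth space_pair_measure)
  then have ae: "AE z in lborel \<Otimes>\<^sub>M ?M. (case z of (u, y) \<Rightarrow> slice i u y) $ i \<notin> N"
    by (simp add: case_prod_beta)
  have [measurable]: "N \<in> sets borel" using N(2) by auto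
  have [measurable]: "(\<lambda>x::real^'n. x $ i) \<in> borel_measurable borel"
    by (intro borel_measurable_continuous_onI continuous_intros)
  have "{x::real^'n. x $ i \<notin> N} \<in> sets borel"
    by measurable
  with ae have "AE x in distr (lborel \<Otimes>\<^sub>M ?M) borel (\<lambda>(u, y). slice i u y). x $ i \<notin> N"
    by (subst AE_distr_iff[OF measurable_slice]) simp_all
  then show ?thesis
    unfolding distr_slice by (rule eventually_mono) (use N(1) in auto)
qed

text \<open>The function \<open>k (x $ i)\<close> need not be integrable on the whole space. The
  ball, however, lies in the cylinder \<open>?C\<close>, bounded in every coordinate other than
  \<open>i\<close>, and there Fubini gives the integral of \<open>k\<close> times the finite measure
  of the cross-section.\<close>

lemma set_integrable_ball_component:
  fixes k :: "real \<Rightarrow> real" and z :: "real ^ 'n"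
  assumes k: "integrable lborel k"
  shows "set_integrable lborel (ball z r) (\<lambda>x. k (x $ i))"
proof -
  let ?M = "\<Pi>\<^sub>M j\<in>UNIV - {i}. lborel :: real measure"
  interpret product_sigma_finite "\<lambda>_. lborel :: real measure" ..
  interpret finite_product_sigma_finite "\<lambda>_. lborel :: real measure" "UNIV - {i}"
    by standard auto
  interpret pair_sigma_finite lborel ?M ..
  let ?C = "{x. \<forall>j. j \<noteq> i \<longrightarrow> x $ j \<in> {z $ j - r .. z $ j + r}}"
  let ?E = "\<Pi>\<^sub>E j\<in>UNIV - {i}. {z $ j - r .. z $ j + r}"
  have [measurable]: "k \<in> borel_measurable borel"
    using borel_measurable_integrable[OF k] by simp
  have comp[measurable]: "(\<lambda>x::real^'n. x $ j) \<in> borel_measurable borel" for j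
    by (intro borel_measurable_continuous_onI continuous_intros)
  have C[measurable]: "?C \<in> sets borel"
    by measurable
  have E: "?E \<in> sets ?M" by auto
  have fin: "emeasure ?M ?E < \<infinity>"
  proof -
    \<comment> \<open>For negative \<open>r\<close> the interval is empty and
      \<open>ennreal (2 * r)\<close> is 0, so no sign condition is involved.\<close>
    have "emeasure lborel {z $ j - r .. z $ j + r} = ennreal (2 * r)" for j
      by (auto simp: emeasure_lborel_Icc_eq ennreal_neg)
    then show ?thesis
      by (subst emeasure_PiM) (auto simp: less_top power_less_top_ennreal)
  qed
  have "integrable (lborel \<Otimes>\<^sub>M ?M) (\<lambda>(u, y). k u * indicator ?E y)"
  proof (rule Fubini_integrable)
    show "(\<lambda>(u, y). k u * indicator ?E y) \<in> borel_measurable (lborel \<Otimes>\<^sub>M ?M)"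
      using E by measurable
    have "integrable lborel (\<lambda>u. norm (k u) * measure ?M ?E)"
      by (intro integrable_mult_left integrable_norm k)
    then show "integrable lborel (\<lambda>x. LINT y|?M. norm (case (x, y) of (u, y) \<Rightarrow> k u * indicator ?E y))"
      using E by (simp add: abs_mult)
    show "AE x in lborel. integrable ?M (\<lambda>y. case (x, y) of (u, y) \<Rightarrow> k u * indicator ?E y)"
      using E fin by (auto intro!: integrable_real_indicator)
  qed
  also have "integrable (lborel \<Otimes>\<^sub>M ?M) (\<lambda>(u, y). k u * indicator ?E y) \<longleftrightarrow>
      integrable (lborel \<Otimes>\<^sub>M ?M) (\<lambda>(u, y). k (slice i u y $ i) * indicator ?C (slice i u y))"
  proof (intro Bochner_Integration.integrable_cong refl)
    fix w :: "real \<times> ('n \<Rightarrow> real)"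
    assume "w \<in> space (lborel \<Otimes>\<^sub>M ?M)"
    then obtain u y where w: "w = (u, y)" and "y \<in> space ?M"
      by (cases w) (auto simp: space_pair_measure)
    then have "y \<in> ?E \<longleftrightarrow> slice i u y \<in> ?C"
      unfolding space_PiM PiE_iff mem_Collect_eq by (simp add: slice_nth) blast
    then have "(indicator ?E y :: real) = indicator ?C (slice i u y)"
      unfolding indicator_def by simp
    then show "(case w of (u, y) \<Rightarrow> k u * indicator ?E y) =
        (case w of (u, y) \<Rightarrow> k (slice i u y $ i) * indicator ?C (slice i u y))"
      unfolding w by (simp add: slice_nth)
  qed
  also have "\<dots> \<longleftrightarrow> integrable lborel (\<lambda>x. k (x $ i) * indicator ?C x)"
    by (rule integrable_slice_iff) measurable
  finally have "set_integrable lborel ?C (\<lambda>x. k (x $ i))"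
    by (simp add: set_integrable_def mult.commute)
  moreover have "ball z r \<subseteq> ?C"
  proof
    fix x assume "x \<in> ball z r"
    then have "\<bar>(x - z) $ j\<bar> < r" for j
      using component_le_norm_cart[of "x - z" j] by (auto simp: dist_norm norm_minus_commute)
    then have "\<bar>x $ j - z $ j\<bar> < r" for j
      by simp
    then show "x \<in> ?C"
      by (simp add: abs_less_iff algebra_simps less_imp_le)
  qed
  ultimately show ?thesis
    using set_integrable_subset by (metis (no_types, lifting) borel_open open_ball sets_lborel)
qed

subsection \<open>Integrating out the remaining coordinates\<close>

lemma integral_eq_diff_if_integrable_derivative:
  fixes F f :: "real \<Rightarrow> real"
  assumes f: "integrable lborel f" and der: "\<And>u. (F has_real_derivative f u) (at u)" and le: "a \<le> b"
  shows "(LINT s:{a..b}|lborel. f s) = F b - F a" and "set_integrable lborel {a..b} f"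
proof -
  have m: "{a..b} \<in> sets lborel" by simp
  show si: "set_integrable lborel {a..b} f"
    using integrable_mult_indicator[OF m f] by (simp add: set_integrable_def)
  have "(f has_integral (F b - F a)) {a..b}"
    using der le by (intro fundamental_theorem_of_calculus)
      (auto intro: has_field_derivative_at_within simp flip: has_real_derivative_iff_has_vector_derivative)
  then show "(LINT s:{a..b}|lborel. f s) = F b - F a"
    using set_borel_integral_eq_integral(2)[OF si] by (simp add: integral_unique)
qed

lemma abs_diff_le_integral_derivative:
  fixes F f :: "real \<Rightarrow> real"
  assumes f: "integrable lborel f" and der: "\<And>u. (F has_real_derivative f u) (at u)"
  shows "\<bar>F b - F a\<bar> \<le> (LINT s|lborel. \<bar>f s\<bar>)"
proof -
  have *: "\<bar>F b - F a\<bar> \<le> (LINT s|lborel. \<bar>f s\<bar>)" if "a \<le> b" for a b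
  proof -
    have "\<bar>F b - F a\<bar> = \<bar>LINT s|lborel. indicator {a..b} s *\<^sub>R f s\<bar>"
      using integral_eq_diff_if_integrable_derivative(1)[OF f der that]
      by (simp add: set_lebesgue_integral_def)
    also have "\<dots> \<le> (LINT s|lborel. \<bar>indicator {a..b} s *\<^sub>R f s\<bar>)"
      using integral_norm_bound[of lborel "\<lambda>s. indicator {a..b} s *\<^sub>R f s"] by simp
    also have "\<dots> \<le> (LINT s|lborel. \<bar>f s\<bar>)"
      using integral_eq_diff_if_integrable_derivative(2)[OF f der that] f
      by (intro integral_mono) (auto simp: set_integrable_def indicator_def)
    finally show ?thesis .
  qed
  show ?thesis
    using *[of a b] *[of b a] by (cases "a \<le> b") auto
qed

section \<open>Parameter integrals controlled by an integrable derivative\<close>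

context
  fixes M :: "'b measure" and \<phi> \<phi>' :: "real \<Rightarrow> 'b \<Rightarrow> real"
  assumes sf: "sigma_finite_measure M"
    and int: "integrable (lborel \<Otimes>\<^sub>M M) (\<lambda>(u, y). \<phi> u y)"
    and int': "integrable (lborel \<Otimes>\<^sub>M M) (\<lambda>(u, y). \<phi>' u y)"
    and der: "\<And>u y. ((\<lambda>u. \<phi> u y) has_real_derivative \<phi>' u y) (at u)"
begin

lemma integrable_integral_derivative: "integrable lborel (\<lambda>u. LINT y|M. \<phi>' u y)"
proof -
  interpret M: sigma_finite_measure M by (fact sf)
  interpret pair_sigma_finite lborel M ..
  show ?thesis using integrable_fst'[OF int'] by simp
qed

text \<open>By Fubini some section \<open>\<phi> u0\<close> is integrable. Every other section
  differs from it by at most the integral of \<open>\<bar>\<phi>' s y\<bar>\<close> over all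
  \<open>s\<close>, which is integrable in \<open>y\<close>. The resulting majorant is uniform in
  \<open>u\<close>.\<close>

lemma section_dominated:
  assumes "\<And>u. \<phi> u \<in> borel_measurable M"
  shows "\<exists>w. integrable M w \<and> (AE y in M. \<forall>u. \<bar>\<phi> u y\<bar> \<le> w y)"
proof -
  interpret M: sigma_finite_measure M by (fact sf)
  interpret pair_sigma_finite lborel M ..
  have "AE u in lborel. integrable M (\<phi> u)"
    using AE_integrable_fst'[OF int] by simp
  \<comment> \<open>What holds almost everywhere holds somewhere, Lebesgue measure being
    nonzero.\<close>
  then have "\<exists>u. integrable M (\<phi> u)"
    by (rule eventually_happens'[rotated]) (simp add: ae_filter_eq_bot_iff)
  then obtain u0 where u0: "integrable M (\<phi> u0)" ..
  have ae: "AE y in M. integrable lborel (\<lambda>u. \<phi>' u y)"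
    using AE_integrable_snd[OF int'] .
  have "integrable M (\<lambda>y. LINT s|lborel. \<bar>\<phi>' s y\<bar>)"
    using integrable_snd[of "\<lambda>u y. \<bar>\<phi>' u y\<bar>"] integrable_norm[OF int'] by (simp add: case_prod_beta')
  with u0 have "integrable M (\<lambda>y. \<bar>\<phi> u0 y\<bar> + (LINT s|lborel. \<bar>\<phi>' s y\<bar>))"
    by simp
  moreover have "AE y in M. \<forall>u. \<bar>\<phi> u y\<bar> \<le> \<bar>\<phi> u0 y\<bar> + (LINT s|lborel. \<bar>\<phi>' s y\<bar>)"
    using ae
  proof eventually_elim
    case (elim y)
    show ?case
    proof
      fix u
      have "\<bar>\<phi> u y - \<phi> u0 y\<bar> \<le> (LINT s|lborel. \<bar>\<phi>' s y\<bar>)"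
        by (rule abs_diff_le_integral_derivative[OF elim der])
      then show "\<bar>\<phi> u y\<bar> \<le> \<bar>\<phi> u0 y\<bar> + (LINT s|lborel. \<bar>\<phi>' s y\<bar>)"
        by linarith
    qed
  qed
  ultimately show ?thesis by blast
qed

text \<open>The uniform majorant improves integrability from almost every \<open>u\<close>, which
  Fubini gives, to every \<open>u\<close>.\<close>

lemma integrable_section:
  assumes "\<And>u. \<phi> u \<in> borel_measurable M"
  shows "integrable M (\<phi> u)"
proof -
  obtain w where w: "integrable M w" "AE y in M. \<forall>u. \<bar>\<phi> u y\<bar> \<le> w y"
    using section_dominated[OF assms] by blast
  show ?thesis
  proof (rule Bochner_Integration.integrable_bound[OF w(1) assms])
    show "AE y in M. norm (\<phi> u y) \<le> norm (w y)"
      using w(2) by eventually_elim (simp add: order_trans[OF _ abs_ge_self])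
  qed
qed

lemma continuous_integral_section:
  assumes "\<And>u. \<phi> u \<in> borel_measurable M"
  shows "continuous_on UNIV (\<lambda>u. LINT y|M. \<phi> u y)"
proof -
  obtain w where w: "integrable M w" "AE y in M. \<forall>u. \<bar>\<phi> u y\<bar> \<le> w y"
    using section_dominated[OF assms] by blast
  have "isCont (\<lambda>u. LINT y|M. \<phi> u y) u" for u
    unfolding continuous_at_sequentially comp_def
  proof (intro allI impI)
    fix x :: "nat \<Rightarrow> real" assume x: "x \<longlonglongrightarrow> u"
    show "(\<lambda>n. LINT y|M. \<phi> (x n) y) \<longlonglongrightarrow> (LINT y|M. \<phi> u y)"
    proof (rule integral_dominated_convergence[OF _ _ w(1)])
      show "AE y in M. (\<lambda>n. \<phi> (x n) y) \<longlonglongrightarrow> \<phi> u y"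
        by (intro AE_I2 isCont_tendsto_compose[OF DERIV_isCont[OF der] x])
      show "AE y in M. norm (\<phi> (x n) y) \<le> w y" for n
        using w(2) by eventually_elim auto
    qed (use assms in auto)
  qed
  then show ?thesis
    by (simp add: continuous_on_eq_continuous_at)
qed

text \<open>An integrated substitute for differentiation under the integral sign: the fundamental
  theorem of calculus in \<open>u\<close> for almost every \<open>y\<close>, then Fubini on the
  strip over \<open>{a..b}\<close>. Joint integrability of \<open>\<phi>'\<close> takes the place of
  a majorant for it.\<close>

lemma integral_section_increment:
  assumes "\<And>u. \<phi> u \<in> borel_measurable M" and le: "a \<le> b"
  shows "(LINT y|M. \<phi> b y) - (LINT y|M. \<phi> a y) = integral {a..b} (\<lambda>s. LINT y|M. \<phi>' s y)"
proof -
  interpret M: sigma_finite_measure M by (fact sf)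
  interpret pair_sigma_finite lborel M ..
  let ?I = "indicator {a..b} :: real \<Rightarrow> real"
  have ae: "AE y in M. integrable lborel (\<lambda>u. \<phi>' u y)"
    using AE_integrable_snd[OF int'] .
  have "{a..b} \<times> space M \<in> sets (lborel \<Otimes>\<^sub>M M)" by simp
  from integrable_mult_indicator[OF this int']
  have I: "integrable (lborel \<Otimes>\<^sub>M M) (\<lambda>(s, y). ?I s * \<phi>' s y)"
    by (rule Bochner_Integration.integrable_cong[THEN iffD1, rotated 2])
      (auto simp: space_pair_measure indicator_def)
  have "(LINT y|M. \<phi> b y) - (LINT y|M. \<phi> a y) = (LINT y|M. \<phi> b y - \<phi> a y)"
    using integrable_section[OF assms(1)] by simp
  also have "\<dots> = (LINT y|M. LINT s|lborel. ?I s * \<phi>' s y)"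
  proof (intro integral_cong_AE)
    show "(\<lambda>y. \<phi> b y - \<phi> a y) \<in> borel_measurable M"
      using assms(1) by simp
    show "(\<lambda>y. LINT s|lborel. ?I s * \<phi>' s y) \<in> borel_measurable M"
      using integrable_snd[OF I] by simp
    show "AE y in M. \<phi> b y - \<phi> a y = (LINT s|lborel. ?I s * \<phi>' s y)"
      using ae
    proof eventually_elim
      case (elim y)
      show ?case
        using integral_eq_diff_if_integrable_derivative(1)[OF elim der le]
        by (simp add: set_lebesgue_integral_def)
    qed
  qed
  also have "\<dots> = (LINT s|lborel. LINT y|M. ?I s * \<phi>' s y)"
    by (rule Fubini_integral[OF I])
  also have "\<dots> = (LINT s:{a..b}|lborel. LINT y|M. \<phi>' s y)"
    by (simp add: set_lebesgue_integral_def)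
  also have "\<dots> = integral {a..b} (\<lambda>s. LINT y|M. \<phi>' s y)"
  proof (rule set_borel_integral_eq_integral(2))
    have "{a..b} \<in> sets lborel" by simp
    from integrable_mult_indicator[OF this integrable_integral_derivative]
    show "set_integrable lborel {a..b} (\<lambda>s. LINT y|M. \<phi>' s y)"
      by (simp add: set_integrable_def)
  qed
  finally show ?thesis .
qed

end

subsection \<open>Functions in ACL1\<close>

lemma dir_deriv_eq:
  assumes "((\<lambda>t. g (x + t *\<^sub>R e)) has_real_derivative d) (at 0)"
  shows "dir_deriv e g x = d" "dir_differentiable e g x"
  using assms by (auto simp: dir_deriv_def dir_differentiable_def DERIV_imp_deriv
      real_differentiable_def)

lemma C1_dir_deriv:
  assumes "C1 f f'"
  shows "dir_deriv e f x = f' x e" "dir_differentiable e f x"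
  using dir_deriv_eq[of f x e "f' x e"] C1_line[OF assms, of x e 0] by auto

section \<open>Products of a function of one coordinate, with integrable weak derivative, and C1
  functions\<close>

context
  fixes k \<gamma> :: "real \<Rightarrow> real" and a b :: "real ^ 'n \<Rightarrow> real" and a' b' and i :: 'n
  assumes k: "integrable lborel k"
    and inc: "\<And>u v. u \<le> v \<Longrightarrow> \<gamma> v - \<gamma> u = integral {u..v} k"
    and cont: "continuous_on UNIV \<gamma>"
    and a: "C1 a a'" and b: "C1 b b'"
begin

text \<open>Along a line in direction \<open>e\<close> the \<open>i\<close>-th coordinate moves with
  constant speed \<open>c = e $ i\<close>, so the increments of \<gamma> are integrals of
  \<open>k\<close> after an affine substitution.\<close>

lemma increment_along_line_le:
  assumes "s \<le> t"
  shows "\<bar>\<gamma> (y + t * c) - \<gamma> (y + s * c)\<bar> \<le> integral {s..t} (\<lambda>r. \<bar>c\<bar> * \<bar>k (y + r * c)\<bar>)"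
    and "(\<lambda>r. \<bar>c\<bar> * \<bar>k (y + r * c)\<bar>) integrable_on {s..t}"
proof -
  have k': "(\<lambda>r. c * k (y + r * c)) absolutely_integrable_on {s..t}"
  proof (cases "c = 0")
    case False
    have "integrable lborel (\<lambda>r. k (y + c * r))"
      using lborel_integrable_real_affine[OF k False] by simp
    then have "integrable lebesgue (\<lambda>r. c * k (y + r * c))"
      by (simp add: mult.commute integrable_completion borel_measurable_integrable)
    then have "(\<lambda>r. c * k (y + r * c)) absolutely_integrable_on UNIV"
      by (simp add: set_integrable_def)
    then show ?thesis
      by (rule set_integrable_subset) auto
  qed auto
  then have abs: "(\<lambda>r. \<bar>c * k (y + r * c)\<bar>) integrable_on {s..t}"
    unfolding absolutely_integrable_on_def by simp
  then show "(\<lambda>r. \<bar>c\<bar> * \<bar>k (y + r * c)\<bar>) integrable_on {s..t}"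
    by (simp add: abs_mult)
  have kint: "(k has_integral integral {u..v} k) (cbox u v)" for u v
    using integrable_integral[OF integrable_on_subinterval[OF integrable_on_lborel[OF k]], of u v] by simp
  \<comment> \<open>The cases differ because the substitution reverses the interval for negative
    \<open>c\<close>; for \<open>c = 0\<close> both sides vanish.\<close>
  have "\<gamma> (y + t * c) - \<gamma> (y + s * c) = integral {s..t} (\<lambda>r. c * k (y + r * c))"
  proof (cases c "0::real" rule: linorder_cases)
    case equal
    then show ?thesis by simp
  next
    case greater
    have "((\<lambda>r. k (c * r + y)) has_integral (1 / \<bar>c\<bar>) *\<^sub>R integral {c * s + y..c * t + y} k)
        ((\<lambda>x. (1 / c) *\<^sub>R x + - ((1 / c) *\<^sub>R y)) ` cbox (c * s + y) (c * t + y))"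
      using has_integral_affinity[OF kint, of c y "c * s + y" "c * t + y"] greater by simp
    moreover have "(\<lambda>x. (1 / c) *\<^sub>R x + - ((1 / c) *\<^sub>R y)) ` cbox (c * s + y) (c * t + y) = {s..t}"
      using greater assms by (subst image_affinity_cbox) (auto simp: field_simps)
    ultimately have "((\<lambda>r. k (c * r + y)) has_integral (1 / \<bar>c\<bar>) *\<^sub>R integral {c * s + y..c * t + y} k) {s..t}"
      by simp
    from has_integral_mult_right[OF this, of c]
    have "((\<lambda>r. c * k (y + r * c)) has_integral integral {c * s + y..c * t + y} k) {s..t}"
      using greater by (simp add: mult.commute add.commute)
    from integral_unique[OF this] show ?thesis
      using inc[of "c * s + y" "c * t + y"] greater assms
      by (simp only:) (simp add: algebra_simps mult_left_mono)
  next
    case less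
    have "((\<lambda>r. k (c * r + y)) has_integral (1 / \<bar>c\<bar>) *\<^sub>R integral {c * t + y..c * s + y} k)
        ((\<lambda>x. (1 / c) *\<^sub>R x + - ((1 / c) *\<^sub>R y)) ` cbox (c * t + y) (c * s + y))"
      using has_integral_affinity[OF kint, of c y "c * t + y" "c * s + y"] less by simp
    moreover have "(\<lambda>x. (1 / c) *\<^sub>R x + - ((1 / c) *\<^sub>R y)) ` cbox (c * t + y) (c * s + y) = {s..t}"
      using less assms by (subst image_affinity_cbox) (auto simp: field_simps)
    ultimately have "((\<lambda>r. k (c * r + y)) has_integral (1 / \<bar>c\<bar>) *\<^sub>R integral {c * t + y..c * s + y} k) {s..t}"
      by simp
    from has_integral_mult_right[OF this, of c]
    have "((\<lambda>r. c * k (y + r * c)) has_integral - integral {c * t + y..c * s + y} k) {s..t}"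
      using less by (simp add: mult.commute add.commute)
    from integral_unique[OF this] show ?thesis
      using inc[of "c * t + y" "c * s + y"] less assms
      by (simp only:) (simp add: algebra_simps mult_left_mono)
  qed
  then show "\<bar>\<gamma> (y + t * c) - \<gamma> (y + s * c)\<bar> \<le> integral {s..t} (\<lambda>r. \<bar>c\<bar> * \<bar>k (y + r * c)\<bar>)"
    using integral_norm_bound_integral[OF set_lebesgue_integral_eq_integral(1)[OF k'] abs]
    by (simp add: abs_mult)
qed

text \<open>The increment splits into \<open>a\<close> times that of \<gamma>, \<gamma> times that
  of \<open>a\<close>, and that of \<open>b\<close>. On a compact interval \<open>a\<close> and
  \<gamma> are bounded by \<open>Ca\<close> and \<open>Cg\<close>, while \<open>a\<close> and
  \<open>b\<close> are Lipschitz along the line with constants \<open>La\<close> and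
  \<open>Lb\<close>. The sum is dominated by the integral of \<open>?w\<close>.\<close>

lemma abs_cont_on_line:
  "abs_cont_on {l..r} (\<lambda>t. \<gamma> ((y + t *\<^sub>R e) $ i) * a (y + t *\<^sub>R e) + b (y + t *\<^sub>R e))"
proof -
  let ?z = "\<lambda>t. y + t *\<^sub>R e"
  let ?c = "e $ i"
  let ?\<gamma> = "\<lambda>t. \<gamma> (y $ i + t * ?c)"
  have cz: "continuous_on S ?z" for S by (intro continuous_intros)
  have bnd: "\<exists>C\<ge>0. \<forall>t\<in>{l..r}. \<bar>h t\<bar> \<le> C" if "continuous_on {l..r} h" for h :: "real \<Rightarrow> real"
    using compact_imp_bounded[OF compact_continuous_image[OF that]]
    unfolding bounded_pos by (auto intro: less_imp_le)
  have lip: "\<exists>L\<ge>0. \<forall>s t. l \<le> s \<longrightarrow> s \<le> t \<longrightarrow> t \<le> r \<longrightarrow> \<bar>f (?z t) - f (?z s)\<bar> \<le> L * (t - s)"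
    if f: "C1 f f'" for f f'
  proof -
    have "continuous_on {l..r} (\<lambda>t. f' (?z t) e)"
      by (intro continuous_intros continuous_on_compose2[OF C1_continuous_deriv[OF f, of UNIV] cz]) auto
    from bnd[OF this] obtain L where L: "L \<ge> 0" "\<And>t. t \<in> {l..r} \<Longrightarrow> \<bar>f' (?z t) e\<bar> \<le> L"
      by blast
    have "\<bar>f (?z t) - f (?z s)\<bar> \<le> L * (t - s)" if "l \<le> s" "s \<le> t" "t \<le> r" for s t
    proof -
      have "norm (f (?z t) - f (?z s)) \<le> L * norm (t - s)"
        using that L(2) C1_line[OF f]
        by (intro field_differentiable_bound[of "{l..r}" _ "\<lambda>t. f' (?z t) e"])
          (auto intro: has_field_derivative_at_within)
      then show ?thesis using that by simp
    qed
    with L(1) show ?thesis by blast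
  qed
  obtain Ca where Ca: "Ca \<ge> 0" "\<And>t. t \<in> {l..r} \<Longrightarrow> \<bar>a (?z t)\<bar> \<le> Ca"
    using bnd[OF continuous_on_compose2[OF C1_continuous[OF a, of UNIV] cz]] by blast
  have "continuous_on {l..r} ?\<gamma>"
    by (rule continuous_on_compose2[OF cont]) (auto intro!: continuous_intros)
  from bnd[OF this] obtain Cg where Cg: "Cg \<ge> 0" "\<And>t. t \<in> {l..r} \<Longrightarrow> \<bar>?\<gamma> t\<bar> \<le> Cg"
    by blast
  obtain La where La: "La \<ge> 0"
      "\<And>s t. l \<le> s \<Longrightarrow> s \<le> t \<Longrightarrow> t \<le> r \<Longrightarrow> \<bar>a (?z t) - a (?z s)\<bar> \<le> La * (t - s)"
    using lip[OF a] by blast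
  obtain Lb where Lb: "Lb \<ge> 0"
      "\<And>s t. l \<le> s \<Longrightarrow> s \<le> t \<Longrightarrow> t \<le> r \<Longrightarrow> \<bar>b (?z t) - b (?z s)\<bar> \<le> Lb * (t - s)"
    using lip[OF b] by blast
  let ?w = "\<lambda>t. Ca * (\<bar>?c\<bar> * \<bar>k (y $ i + t * ?c)\<bar>) + (Cg * La + Lb)"
  have "abs_cont_on {l..r} (\<lambda>t. ?\<gamma> t * a (?z t) + b (?z t))"
  proof (cases "l \<le> r")
    case True
    show ?thesis
    proof (rule abs_cont_on_if_increment_le_integral)
      show "?w integrable_on {l..r}"
        by (intro integrable_add integrable_const_ivl
            integrable_on_mult_right[OF increment_along_line_le(2)[OF True]])
      show "0 \<le> ?w t" for t
        using Ca(1) Cg(1) La(1) Lb(1) by simp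
      fix s t assume st: "l \<le> s" "s \<le> t" "t \<le> r"
      note i1 = increment_along_line_le[OF st(2), where y = "y $ i" and c = "?c"]
      have "\<bar>?\<gamma> t * a (?z t) + b (?z t) - (?\<gamma> s * a (?z s) + b (?z s))\<bar> =
         \<bar>a (?z t) * (?\<gamma> t - ?\<gamma> s) + ?\<gamma> s * (a (?z t) - a (?z s)) + (b (?z t) - b (?z s))\<bar>"
        by (simp add: algebra_simps)
      also have "\<dots> \<le> \<bar>a (?z t) * (?\<gamma> t - ?\<gamma> s)\<bar> + \<bar>?\<gamma> s * (a (?z t) - a (?z s))\<bar> + \<bar>b (?z t) - b (?z s)\<bar>"
        by linarith
      also have "\<dots> \<le> Ca * integral {s..t} (\<lambda>r. \<bar>?c\<bar> * \<bar>k (y $ i + r * ?c)\<bar>) + Cg * (La * (t - s)) + Lb * (t - s)"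
        unfolding abs_mult using st Ca Cg La(2)[OF st] Lb(2)[OF st] i1(1)
        by (intro add_mono mult_mono) auto
      also have "\<dots> = integral {s..t} ?w"
        using i1(2) st(2)
        by (subst integral_add[OF integrable_on_mult_right[OF i1(2)] integrable_const_ivl])
          (simp add: algebra_simps)
      finally show "\<bar>?\<gamma> t * a (?z t) + b (?z t) - (?\<gamma> s * a (?z s) + b (?z s))\<bar> \<le> integral {s..t} ?w" .
    qed
  next
    case False
    then show ?thesis
      by (intro abs_cont_on_if_increment_le_integral[of ?w]) auto
  qed
  then show ?thesis by simp
qed

text \<open>The exceptional set is the cylinder over the points where \<gamma> fails to have
  derivative \<open>k\<close>; it is null. Elsewhere the product rule applies.\<close>

lemma AE_dir_deriv:
  "AE x in lborel. dir_deriv e (\<lambda>x. \<gamma> (x $ i) * a x + b x) x =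
     e $ i * k (x $ i) * a x + \<gamma> (x $ i) * a' x e + b' x e"
proof -
  have "AE u in lborel. (\<gamma> has_real_derivative k u) (at u)"
    by (rule AE_derivative_if_increment_eq_integral[OF k inc])
  from AE_component[OF this, of i] show ?thesis
  proof eventually_elim
    case (elim x)
    have "((\<lambda>t. \<gamma> (x $ i + t * e $ i)) has_real_derivative k (x $ i) * e $ i) (at 0)"
      by (rule DERIV_chain'[where g = \<gamma>, unfolded comp_def]) (use elim in \<open>auto intro!: derivative_eq_intros\<close>)
    then have "((\<lambda>t. \<gamma> ((x + t *\<^sub>R e) $ i) * a (x + t *\<^sub>R e) + b (x + t *\<^sub>R e)) has_real_derivative
        e $ i * k (x $ i) * a x + \<gamma> (x $ i) * a' x e + b' x e) (at 0)"
      using C1_line[OF a, of x e 0] C1_line[OF b, of x e 0]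
      by (auto intro!: derivative_eq_intros simp: algebra_simps)
    then show ?case
      by (rule dir_deriv_eq)
  qed
qed

lemma set_integrable_ball_continuous:
  fixes h :: "real ^ 'n \<Rightarrow> real"
  assumes "continuous_on UNIV h"
  shows "set_integrable lborel (ball x r) h"
proof -
  have "set_integrable lborel (cball x r) h"
    using borel_integrable_compact[OF compact_cball continuous_on_subset[OF assms]]
    by (simp add: set_integrable_def)
  then show ?thesis
    by (rule set_integrable_subset) auto
qed

text \<open>Unit balls serve as neighbourhoods. In the almost everywhere formula for the directional
  derivative only \<open>k (x $ i) * a x\<close> may be unbounded on a ball; it is controlled by a
  bound for \<open>a\<close> and the integrability of \<open>k (x $ i)\<close> there. The remaining
  terms are continuous.\<close>

lemma ACL1_loc_component_mult:
  "ACL1_loc UNIV (\<lambda>x. \<gamma> (x $ i) * a x + b x)"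
proof -
  let ?f = "\<lambda>x. \<gamma> (x $ i) * a x + b x"
  have ci: "continuous_on UNIV (\<lambda>x::real^'n. x $ i)"
    by (intro continuous_intros)
  have cg: "continuous_on UNIV (\<lambda>x::real^'n. \<gamma> (x $ i))"
    by (rule continuous_on_compose2[OF cont ci]) auto
  have cf: "continuous_on UNIV ?f"
    by (intro continuous_intros cg C1_continuous[OF a] C1_continuous[OF b])
  \<comment> \<open>Absolute continuity holds on every line, so no computation with
    \<open>perp_lebesgue\<close> is involved.\<close>
  have ACL: "ACL U ?f" if "open U" for U
    unfolding ACL_def using abs_cont_on_line continuous_on_subset[OF cf]
    by (auto intro!: borel_measurable_continuous_on_restrict)
  have "set_integrable lebesgue (ball z 1) (dir_deriv e ?f)" for z e
  proof -
    have "bounded (a ` cball z 1)"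
      by (intro compact_imp_bounded compact_continuous_image C1_continuous[OF a]) auto
    then obtain C where C: "\<forall>x\<in>cball z 1. \<bar>a x\<bar> \<le> C"
      unfolding bounded_iff by auto
    have "k \<in> borel_measurable borel"
      using borel_measurable_integrable[OF k] by simp
    from measurable_compose[OF borel_measurable_continuous_onI[OF ci] this]
    have meas: "(\<lambda>x. k (x $ i) * a x) \<in> borel_measurable borel"
      by (intro borel_measurable_times borel_measurable_continuous_onI[OF C1_continuous[OF a]])
    have ka: "set_integrable lborel (ball z 1) (\<lambda>x. k (x $ i) * a x)"
    proof -
      have "set_integrable lborel (ball z 1) (\<lambda>x. C * k (x $ i))"
        by (intro set_integrable_mult_right set_integrable_ball_component k)
      then show ?thesis
        unfolding set_integrable_def
      proof (rule Bochner_Integration.integrable_bound)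
        show "(\<lambda>x. indicator (ball z 1) x *\<^sub>R (k (x $ i) * a x)) \<in> borel_measurable lborel"
          using meas by (intro borel_measurable_scaleR borel_measurable_indicator) auto
        have "\<bar>k (x $ i) * a x\<bar> \<le> \<bar>C * k (x $ i)\<bar>" if "x \<in> ball z 1" for x
        proof -
          have "\<bar>a x\<bar> \<le> \<bar>C\<bar>" using bspec[OF C, of x] that by auto
          then show ?thesis by (simp add: abs_mult mult.commute mult_right_mono)
        qed
        then show "AE x in lborel. norm (indicator (ball z 1) x *\<^sub>R (k (x $ i) * a x))
            \<le> norm (indicator (ball z 1) x *\<^sub>R (C * k (x $ i)))"
          by (auto simp: indicator_def)
      qed
    qed
    have "set_integrable lborel (ball z 1) (\<lambda>x. \<gamma> (x $ i) * a' x e + b' x e)"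
      by (intro set_integrable_ball_continuous continuous_intros cg
          C1_continuous_deriv[OF a] C1_continuous_deriv[OF b])
    from set_integral_add(1)[OF set_integrable_mult_right[OF ka] this]
    have "set_integrable lborel (ball z 1)
        (\<lambda>x. e $ i * (k (x $ i) * a x) + (\<gamma> (x $ i) * a' x e + b' x e))"
      by simp
    then have 1: "set_integrable lebesgue (ball z 1)
        (\<lambda>x. e $ i * k (x $ i) * a x + \<gamma> (x $ i) * a' x e + b' x e)"
      unfolding set_integrable_def
      by (simp add: integrable_completion borel_measurable_integrable algebra_simps)
    have ae: "AE x in lebesgue. e $ i * k (x $ i) * a x + \<gamma> (x $ i) * a' x e + b' x e = dir_deriv e ?f x"
      using AE_dir_deriv[of e] by (intro AE_completion) (auto elim!: eventually_mono)
    show ?thesis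
      unfolding set_integrable_def
    proof (rule integrable_cong_AE_imp[OF 1[unfolded set_integrable_def]])
      show "AE x in lebesgue. indicator (ball z 1) x *\<^sub>R
          (e $ i * k (x $ i) * a x + \<gamma> (x $ i) * a' x e + b' x e) =
          indicator (ball z 1) x *\<^sub>R dir_deriv e ?f x"
        using ae by eventually_elim simp
      \<comment> \<open>Since \<open>lebesgue\<close> is complete, \<open>dir_deriv\<close> inherits
        measurability from a function that agrees with it almost everywhere.\<close>
      show "(\<lambda>x. indicator (ball z 1) x *\<^sub>R dir_deriv e ?f x) \<in> borel_measurable lebesgue"
        using ae borel_measurable_integrable[OF 1[unfolded set_integrable_def]]
        by (rule_tac borel_measurable_AE) (auto elim!: eventually_mono)
    qed
  qed
  then have "ACL1 (ball z 1) ?f" for z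
    using ACL[OF open_ball] by (simp add: ACL1_def)
  then show ?thesis
    unfolding ACL1_loc_def by (metis centre_in_ball open_ball subset_UNIV zero_less_one)
qed

end

subsection \<open>The Stein kernel\<close>

lemma has_real_derivative_set_integral_atMost:
  fixes f :: "real \<Rightarrow> real"
  assumes f: "integrable lborel f" and cont: "continuous_on UNIV f"
  shows "((\<lambda>u. LINT v:{..u}|lborel. f v) has_real_derivative f u) (at u)"
proof (rule has_real_derivative_if_increment_eq_integral[OF _ cont])
  fix a b :: real assume "a \<le> b"
  have si: "set_integrable lborel S f" if "S \<in> sets borel" for S
    using integrable_mult_indicator[of S lborel f] that f by (simp add: set_integrable_def)
  \<comment> \<open>The half-open interval makes the union disjoint; its missing endpoint is then
    restored as a null set.\<close>
  have "{..b} = {..a} \<union> {a<..b}" using \<open>a \<le> b\<close> by auto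
  then have "(LINT v:{..b}|lborel. f v) = (LINT v:{..a}|lborel. f v) + (LINT v:{a<..b}|lborel. f v)"
    by (simp only:) (rule set_integral_Un, auto intro!: si)
  also have "(LINT v:{a<..b}|lborel. f v) = (LINT v:{a..b}|lborel. f v)"
    unfolding set_lebesgue_integral_def
  proof (rule integral_cong_AE)
    show "AE v in lborel. indicator {a<..b} v *\<^sub>R f v = indicator {a..b} v *\<^sub>R f v"
      using AE_lborel_singleton[of a] by eventually_elim (auto simp: indicator_def)
  qed (use si[of "{a<..b}"] si[of "{a..b}"] in \<open>auto simp: set_integrable_def\<close>)
  also have "(LINT v:{a..b}|lborel. f v) = integral {a..b} f"
    by (rule set_borel_integral_eq_integral(2)) (simp add: si)
  finally show "(LINT v:{..b}|lborel. f v) - (LINT v:{..a}|lborel. f v) = integral {a..b} f"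
    by simp
qed

lemma measurable_slice_section:
  "slice i u \<in> (\<Pi>\<^sub>M j\<in>UNIV - {i}. lborel) \<rightarrow>\<^sub>M borel"
proof -
  have "Pair u \<in> (\<Pi>\<^sub>M j\<in>UNIV - {i}. lborel :: real measure) \<rightarrow>\<^sub>M lborel \<Otimes>\<^sub>M (\<Pi>\<^sub>M j\<in>UNIV - {i}. lborel :: real measure)"
    by (rule measurable_Pair1') simp
  from measurable_compose[OF this measurable_slice] show ?thesis by simp
qed

lemma C1_slice:
  assumes "C1 f f'"
  shows "((\<lambda>u. f (slice i u y)) has_real_derivative f' (slice i u y) (axis i 1)) (at u)"
  using C1_line[OF assms, of "slice i 0 y" "axis i 1" u] by (simp only: slice_shift)

lemma norm_scaleR_le_second_moment:
  fixes x :: "'a::real_normed_vector" and c :: real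
  assumes "0 \<le> c"
  shows "c * norm x \<le> c + (norm x)\<^sup>2 * c"
proof -
  \<comment> \<open>Expanding the square of \<open>norm x - 1 / 2\<close> even gives the bound with
    1/4 in place of 1.\<close>
  have "norm x \<le> 1 + (norm x)\<^sup>2"
    using zero_le_power2[of "norm x - 1 / 2"] by (simp add: power2_eq_square algebra_simps)
  from mult_left_mono[OF this assms] show ?thesis
    by (simp add: algebra_simps)
qed

locale C2_density =
  fixes p :: "real ^ 'n \<Rightarrow> real" and i :: 'n
    and G :: "real ^ 'n \<Rightarrow> real ^ 'n" and H :: "real ^ 'n \<Rightarrow> real ^ 'n ^ 'n"
  assumes pos: "\<And>x. 0 < p x"
    and pdf: "is_pdf p"
    and G: "\<And>x. (p has_derivative (\<lambda>h. G x \<bullet> h)) (at x)"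
    and H: "\<And>x. (G has_derivative (\<lambda>h. H x *v h)) (at x)"
    and cH: "continuous_on UNIV H"
    and fisher: "integrable lborel (\<lambda>x. (norm (gradient p x))\<^sup>2 / p x)"
    and hess: "integrable lborel (\<lambda>x. norm (hessian p x))"
    and variance: "integrable lborel (\<lambda>x. (norm x)\<^sup>2 * p x)"
begin

abbreviation "M \<equiv> (\<Pi>\<^sub>M j\<in>UNIV - {i}. lborel :: real measure)"
abbreviation "q \<equiv> marginal p i"
abbreviation "dq u \<equiv> LINT y|M. G (slice i u y) $ i"
abbreviation "ddq u \<equiv> LINT y|M. H (slice i u y) $ i $ i"

section \<open>Regularity and integrability of the partial derivatives of the density\<close>

lemma C1_p: "C1 p (\<lambda>x. blinfun_inner_left (G x))"
  unfolding C1_def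
proof (intro conjI allI)
  show "(p has_derivative blinfun_inner_left (G x)) (at x)" for x
    using G[of x] by (simp add: inner_commute)
  have "continuous_on UNIV G"
    by (intro continuous_at_imp_continuous_on ballI has_derivative_continuous[OF H])
  then show "continuous_on UNIV (\<lambda>x. blinfun_inner_left (G x))"
    by (intro continuous_intros)
qed

lemma C1_partial: "C1 (\<lambda>x. G x $ i) (\<lambda>x. blinfun_inner_left (H x $ i))"
  unfolding C1_def
proof (intro conjI allI)
  show "((\<lambda>x. G x $ i) has_derivative blinfun_inner_left (H x $ i)) (at x)" for x
    using bounded_linear.has_derivative[OF bounded_linear_vec_nth[of i] H[of x]]
    by (simp add: matrix_vector_mul_component inner_commute)
  show "continuous_on UNIV (\<lambda>x. blinfun_inner_left (H x $ i))"
    by (intro continuous_intros cH)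
qed

lemma continuous_second_partial: "continuous_on UNIV (\<lambda>x. H x $ i $ i)"
  by (intro continuous_intros cH)

lemma borel_measurable_p: "p \<in> borel_measurable borel"
  and borel_measurable_partial: "(\<lambda>x. G x $ i) \<in> borel_measurable borel"
  and borel_measurable_second_partial: "(\<lambda>x. H x $ i $ i) \<in> borel_measurable borel"
  by (intro borel_measurable_continuous_onI C1_continuous[OF C1_p] C1_continuous[OF C1_partial]
      continuous_second_partial)+

lemma gradient_p: "gradient p x = G x"
  using C1_dir_deriv(1)[OF C1_p]
  by (simp add: gradient_def vec_eq_iff inner_axis' )

lemma hessian_p: "hessian p x $ i $ i = H x $ i $ i"
proof -
  have "dir_deriv (axis i 1) p = (\<lambda>x. G x $ i)"
    using C1_dir_deriv(1)[OF C1_p] by (simp add: fun_eq_iff inner_axis')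
  then show ?thesis
    using C1_dir_deriv(1)[OF C1_partial, of "axis i 1" x]
    by (simp add: hessian_def inner_axis')
qed

lemma integrable_p: "integrable lborel p" and integral_p: "integral\<^sup>L lborel p = 1"
  using pdf by (auto simp: is_pdf_def has_bochner_integral_iff)

text \<open>The Fisher information enters here: for \<open>g = \<bar>G x $ i\<bar>\<close> the
  inequality \<open>2 * g * p x \<le> g\<^sup>2 + (p x)\<^sup>2\<close> bounds \<open>g\<close> by
  the integrable function \<open>g\<^sup>2 / p x + p x\<close>.\<close>

lemma integrable_partial: "integrable lborel (\<lambda>x. G x $ i)"
proof (rule Bochner_Integration.integrable_bound)
  show "integrable lborel (\<lambda>x. (norm (gradient p x))\<^sup>2 / p x + p x)"
    by (intro Bochner_Integration.integrable_add fisher integrable_p)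
  have "\<bar>G x $ i\<bar> \<le> (norm (gradient p x))\<^sup>2 / p x + p x" for x
  proof -
    let ?g = "\<bar>G x $ i\<bar>"
    have "0 \<le> ?g * p x" using pos[of x] by (simp add: less_imp_le)
    moreover have "2 * ?g * p x \<le> ?g\<^sup>2 + (p x)\<^sup>2"
      by (rule sum_squares_bound)
    ultimately have "?g * p x \<le> ?g\<^sup>2 + (p x)\<^sup>2"
      by linarith
    then have "?g \<le> (?g\<^sup>2 + (p x)\<^sup>2) / p x"
      using pos[of x] by (simp only: pos_le_divide_eq)
    also have "\<dots> = ?g\<^sup>2 / p x + p x"
      using pos[of x] by (simp add: add_divide_distrib power2_eq_square)
    also have "?g\<^sup>2 \<le> (norm (gradient p x))\<^sup>2"
      unfolding gradient_p by (intro power_mono component_le_norm_cart) simp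
    finally show ?thesis using pos[of x] by (simp add: divide_right_mono)
  qed
  then show "AE x in lborel. norm (G x $ i) \<le> norm ((norm (gradient p x))\<^sup>2 / p x + p x)"
    by (intro AE_I2) (metis abs_ge_self order_trans real_norm_def)
qed (simp add: borel_measurable_partial)

lemma integrable_second_partial: "integrable lborel (\<lambda>x. H x $ i $ i)"
proof (rule Bochner_Integration.integrable_bound[OF hess])
  have "\<bar>H x $ i $ i\<bar> \<le> norm (hessian p x)" for x
    unfolding hessian_p[symmetric]
    by (rule order_trans[OF component_le_norm_cart Finite_Cartesian_Product.norm_nth_le])
  then show "AE x in lborel. norm (H x $ i $ i) \<le> norm (norm (hessian p x))"
    by simp
qed (simp add: borel_measurable_second_partial)

lemma integrable_first_moment: "integrable lborel (\<lambda>x. p x *\<^sub>R x)"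
proof (rule Bochner_Integration.integrable_bound)
  show "integrable lborel (\<lambda>x. p x + (norm x)\<^sup>2 * p x)"
    by (intro Bochner_Integration.integrable_add variance integrable_p)
  show "AE x in lborel. norm (p x *\<^sub>R x) \<le> norm (p x + (norm x)\<^sup>2 * p x)"
    using norm_scaleR_le_second_moment[OF less_imp_le[OF pos]] pos
    by (intro AE_I2) (auto simp: less_imp_le intro: order_trans[OF _ abs_ge_self])
  have [measurable]: "p \<in> borel_measurable borel" by (rule borel_measurable_p)
  show "(\<lambda>x. p x *\<^sub>R x) \<in> borel_measurable lborel" by measurable
qed

section \<open>The marginal density and its derivatives\<close>

lemma marginal_eq: "q u = (LINT y|M. p (slice i u y))"
  by (simp add: marginal_def slice_def)

lemma slice_section_measurable:
  "f \<in> borel_measurable borel \<Longrightarrow> (\<lambda>y. f (slice i u y)) \<in> borel_measurable M"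
  by (rule measurable_compose[OF measurable_slice_section])

lemma sigma_finite_M: "sigma_finite_measure M"
  by (rule sigma_finite_PiM_lborel) simp

lemma slice_p: "integrable (lborel \<Otimes>\<^sub>M M) (\<lambda>(u, y). p (slice i u y))"
  by (subst integrable_slice_iff) (auto simp: borel_measurable_p integrable_p)

lemma slice_partial: "integrable (lborel \<Otimes>\<^sub>M M) (\<lambda>(u, y). G (slice i u y) $ i)"
  using integrable_slice_iff[OF borel_measurable_partial] integrable_partial by simp

lemma slice_second_partial: "integrable (lborel \<Otimes>\<^sub>M M) (\<lambda>(u, y). H (slice i u y) $ i $ i)"
  using integrable_slice_iff[OF borel_measurable_second_partial] integrable_second_partial by simp

lemma derivative_slice_p:
  "((\<lambda>u. p (slice i u y)) has_real_derivative G (slice i u y) $ i) (at u)"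
  using C1_slice[OF C1_p, of i y u] by (simp add: inner_axis')

lemma derivative_slice_partial:
  "((\<lambda>u. G (slice i u y) $ i) has_real_derivative H (slice i u y) $ i $ i) (at u)"
  using C1_slice[OF C1_partial, of i y u] by (simp add: inner_axis')

text \<open>The Hessian hypothesis enters here: the integrable second partial controls the variation
  of the first one in the \<open>i\<close>-th coordinate.\<close>

lemma continuous_dq: "continuous_on UNIV (\<lambda>u. dq u)"
  by (rule continuous_integral_section[OF sigma_finite_M slice_partial slice_second_partial
        derivative_slice_partial])
    (rule slice_section_measurable[OF borel_measurable_partial])

lemma dq_increment: "a \<le> b \<Longrightarrow> dq b - dq a = integral {a..b} (\<lambda>u. ddq u)"
  by (rule integral_section_increment[OF sigma_finite_M slice_partial slice_second_partial
        derivative_slice_partial])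
    (rule slice_section_measurable[OF borel_measurable_partial])

lemma integrable_ddq: "integrable lborel (\<lambda>u. ddq u)"
  by (rule integrable_integral_derivative[OF sigma_finite_M slice_partial slice_second_partial
        derivative_slice_partial])

text \<open>Continuity of \<open>dq\<close> turns the integrated identity into a derivative at every
  point.\<close>

lemma q_derivative: "(q has_real_derivative dq u) (at u)"
proof (rule has_real_derivative_if_increment_eq_integral[OF _ continuous_dq])
  fix a b :: real assume "a \<le> b"
  then show "q b - q a = integral {a..b} (\<lambda>u. dq u)"
    unfolding marginal_eq
    by (intro integral_section_increment[OF sigma_finite_M slice_p slice_partial derivative_slice_p]
        slice_section_measurable borel_measurable_p)
qed

lemma continuous_q: "continuous_on S q"
  using q_derivative DERIV_isCont continuous_at_imp_continuous_on by blast

text \<open>If \<open>q u\<close> vanished, the strictly positive \<open>p\<close> would be zero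
  \<open>M\<close>-almost everywhere on the slice. Then \<open>M\<close> would be the zero measure,
  and Fubini would make the integral of \<open>p\<close> equal to 0 instead of 1.\<close>

lemma q_pos: "0 < q u"
proof -
  have int: "integrable M (\<lambda>y. p (slice i u y))"
    by (rule integrable_section[OF sigma_finite_M slice_p slice_partial derivative_slice_p])
      (rule slice_section_measurable[OF borel_measurable_p])
  have "q u \<noteq> 0"
  proof
    assume "q u = 0"
    then have "AE y in M. p (slice i u y) = 0"
      using integral_nonneg_eq_0_iff_AE[OF int] pos by (simp add: marginal_eq less_imp_le)
    then have "AE y in M. False"
      by eventually_elim (use pos in \<open>metis less_irrefl\<close>)
    then have "(LINT y|M. f y) = 0" for f :: "('n \<Rightarrow> real) \<Rightarrow> real"
      by (intro integral_eq_zero_AE) (auto elim!: eventually_mono)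
    moreover
    interpret sigma_finite_measure M by (rule sigma_finite_M)
    interpret pair_sigma_finite lborel M ..
    have "(LINT u|lborel. LINT y|M. p (slice i u y)) = 1"
      using integral_fst'[OF slice_p] integral_slice[OF borel_measurable_p, of i] integral_p
      by simp
    ultimately show False by simp
  qed
  moreover have "0 \<le> q u"
    unfolding marginal_eq using pos by (intro Bochner_Integration.integral_nonneg) (simp add: less_imp_le)
  ultimately show ?thesis by simp
qed

lemma integrable_q: "integrable lborel q"
  and integrable_q_moment: "integrable lborel (\<lambda>u. q u * u)"
  and pdf_mean_q: "pdf_mean q = pdf_mean p $ i"
proof -
  interpret sigma_finite_measure M by (rule sigma_finite_M)
  interpret pair_sigma_finite lborel M ..
  show "integrable lborel q"
    using integrable_fst'[OF slice_p] by (simp add: marginal_eq[abs_def])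
  have m: "(\<lambda>x. p x * x $ i) \<in> borel_measurable borel"
    by (intro borel_measurable_continuous_onI continuous_intros C1_continuous[OF C1_p])
  have i: "integrable lborel (\<lambda>x. p x * x $ i)"
    using integrable_bounded_linear[OF bounded_linear_vec_nth[of i] integrable_first_moment] by simp
  have s: "integrable (lborel \<Otimes>\<^sub>M M) (\<lambda>(u, y). p (slice i u y) * slice i u y $ i)"
    using integrable_slice_iff[OF m] i by simp
  have eq: "(LINT y|M. p (slice i u y) * slice i u y $ i) = q u * u" for u
    by (simp add: slice_nth marginal_eq)
  show "integrable lborel (\<lambda>u. q u * u)"
    using integrable_fst'[OF s] by (simp add: eq)
  have "pdf_mean q = (LINT u|lborel. q u * u)"
    by (simp add: pdf_mean_def)
  also have "\<dots> = (LINT x|lborel. p x * x $ i)"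
    using integral_fst'[OF s] integral_slice[OF m, of i] by (simp add: eq)
  also have "\<dots> = pdf_mean p $ i"
    using integral_bounded_linear[OF bounded_linear_vec_nth[of i] integrable_first_moment]
    by (simp add: pdf_mean_def)
  finally show "pdf_mean q = pdf_mean p $ i" .
qed

section \<open>The Stein kernel of the marginal\<close>

abbreviation "T \<equiv> stein_kernel_1d q"
abbreviation "dT u \<equiv> (pdf_mean p $ i - u) - T u * score q u"

lemma score_q: "score q u = dq u / q u"
  using DERIV_imp_deriv[OF q_derivative] by (simp add: score_def)

text \<open>The quotient rule: the numerator of \<open>T\<close> has derivative
  \<open>(pdf_mean q - u) * q u\<close>, and the mean of \<open>q\<close> is the \<open>i\<close>-th
  component of the mean of \<open>p\<close>.\<close>

lemma T_derivative: "(T has_real_derivative dT u) (at u)"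
proof -
  let ?f = "\<lambda>v. (pdf_mean q - v) * q v"
  have "integrable lborel (\<lambda>v. pdf_mean q * q v - q v * v)"
    by (intro Bochner_Integration.integrable_diff integrable_mult_right integrable_q integrable_q_moment)
  then have "integrable lborel ?f"
    by (simp add: algebra_simps)
  moreover have "continuous_on UNIV ?f"
    by (intro continuous_intros continuous_q)
  ultimately have "((\<lambda>u. LINT v:{..u}|lborel. ?f v) has_real_derivative ?f u) (at u)"
    by (rule has_real_derivative_set_integral_atMost)
  from DERIV_divide[OF this q_derivative[of u]] q_pos[of u]
  have "((\<lambda>u. (LINT v:{..u}|lborel. ?f v) / q u) has_real_derivative dT u) (at u)"
    by (simp add: stein_kernel_1d_def score_q pdf_mean_q field_simps)
  then show ?thesis
    by (simp add: stein_kernel_1d_def[abs_def])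
qed

lemma continuous_T: "continuous_on S T"
  using T_derivative DERIV_isCont continuous_at_imp_continuous_on by blast

lemma continuous_dT: "continuous_on UNIV (\<lambda>u. dT u)"
  unfolding score_q
  by (intro continuous_intros continuous_T continuous_q continuous_dq) (metis less_irrefl q_pos)

text \<open>With one coordinate the slice does not depend on \<open>y\<close>, so \<open>q\<close>
  and \<open>dq\<close> are \<open>p\<close> and its derivative times the same mass of
  \<open>M\<close>. The mass cancels in the score; it is nonzero because \<open>q\<close> is
  positive.\<close>

lemma score_single_coordinate:
  assumes "UNIV = {i}"
  shows "score q (x $ i) * p x = G x $ i"
proof -
  have "slice i (x $ i) y = x" for y
    using assms by (auto simp: vec_eq_iff slice_nth)
  then have "q (x $ i) = measure M (space M) * p x" "dq (x $ i) = measure M (space M) * G x $ i"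
    by (simp_all add: marginal_eq)
  with q_pos[of "x $ i"] show ?thesis
    by (auto simp: score_q)
qed

lemma ACL1_loc_component:
  assumes "C1 a a'" "C1 b b'"
  shows "ACL1_loc UNIV (\<lambda>x. dq (x $ i) * a x + b x)"
  by (rule ACL1_loc_component_mult[OF integrable_ddq dq_increment continuous_dq assms])

text \<open>In dimension one the choice is forced to be \<open>i\<close> itself.\<close>

definition other :: 'n where "other = (SOME j. j \<noteq> i)"

lemma single_coordinate_if_other_eq: "other = i \<Longrightarrow> UNIV = {i}"
  using someI_ex[of "\<lambda>j. j \<noteq> i"] unfolding other_def by fastforce

section \<open>The vector field and its weighted divergence\<close>

definition primitives :: "(real ^ 'n \<Rightarrow> real) \<Rightarrow> (real ^ 'n \<Rightarrow> real) \<Rightarrow> bool" where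
  "primitives A B \<longleftrightarrow>
     (\<exists>A'. C1 A A' \<and> (\<forall>x. A' x (axis other 1) = p x)) \<and>
     (\<exists>B'. C1 B B' \<and> (\<forall>x. B' x (axis other 1) = G x $ i))"

lemma ex_primitives: "\<exists>A B. primitives A B"
  unfolding primitives_def
  using C1_line_integral[OF C1_p, of "axis other 1"] C1_line_integral[OF C1_partial, of "axis other 1"]
  by auto

text \<open>The test \<open>k = i\<close> comes first, so in dimension one, where
  \<open>other\<close> equals \<open>i\<close>, the field is constantly 1.\<close>

definition score_field :: "(real ^ 'n \<Rightarrow> real) \<Rightarrow> (real ^ 'n \<Rightarrow> real) \<Rightarrow> real ^ 'n \<Rightarrow> real ^ 'n" where
  "score_field A B x = (\<chi> k. if k = i then 1
     else if k = other then (score q (x $ i) * A x - B x) / p x else 0)"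

text \<open>The weight \<theta> lets one computation serve twice: the constant 1 gives the score
  equation, and \<open>T\<close> gives the Stein equation. In direction \<open>other\<close>, if it
  differs from \<open>i\<close>, the coordinate \<open>x $ i\<close> is fixed, so \<theta> and the
  score behave as constants and the score is never differentiated.\<close>

lemma weighted_score_field_partial:
  fixes \<theta> :: "real \<Rightarrow> real"
  assumes AB: "primitives A B" and \<theta>: "\<And>u. (\<theta> has_real_derivative \<theta>' u) (at u)"
  shows "((\<lambda>t. (p (x + t *\<^sub>R axis k 1) *\<^sub>R (\<theta> ((x + t *\<^sub>R axis k 1) $ i) *\<^sub>R score_field A B (x + t *\<^sub>R axis k 1))) $ k)
      has_real_derivative
        (if k = i then \<theta>' (x $ i) * p x + \<theta> (x $ i) * G x $ i
         else if k = other then \<theta> (x $ i) * (score q (x $ i) * p x - G x $ i) else 0)) (at 0)"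
proof -
  obtain A' B' where A: "C1 A A'" "\<And>x. A' x (axis other 1) = p x"
      and B: "C1 B B'" "\<And>x. B' x (axis other 1) = G x $ i"
    using AB unfolding primitives_def by blast
  consider "k = i" | "k \<noteq> i" "k = other" | "k \<noteq> i" "k \<noteq> other" by blast
  then show ?thesis
  proof cases
    case 1
    have "((\<lambda>t. p (x + t *\<^sub>R axis i 1)) has_real_derivative G x $ i) (at 0)"
      using C1_line[OF C1_p, of x "axis i 1" 0] by (simp add: inner_axis')
    moreover have "((\<lambda>t. \<theta> (x $ i + t)) has_real_derivative \<theta>' (x $ i)) (at 0)"
      using \<theta>[of "x $ i"] DERIV_shift[of \<theta> "\<theta>' (x $ i)" 0 "x $ i"] by (simp add: add.commute)
    ultimately have "((\<lambda>t. p (x + t *\<^sub>R axis i 1) * \<theta> (x $ i + t)) has_real_derivative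
        \<theta>' (x $ i) * p x + \<theta> (x $ i) * G x $ i) (at 0)"
      by (auto intro!: derivative_eq_intros)
    then show ?thesis using 1 by (simp add: score_field_def)
  next
    case 2
    have "axis other (1::real) $ i = 0"
      using 2 by (simp add: axis_def)
    moreover have "p z \<noteq> 0" for z
      using pos[of z] by simp
    moreover have "((\<lambda>t. \<theta> (x $ i) * (score q (x $ i) * A (x + t *\<^sub>R axis other 1) - B (x + t *\<^sub>R axis other 1)))
        has_real_derivative \<theta> (x $ i) * (score q (x $ i) * p x - G x $ i)) (at 0)"
      using C1_line[OF A(1), of x "axis other 1" 0] C1_line[OF B(1), of x "axis other 1" 0]
      by (auto intro!: derivative_eq_intros simp: A(2) B(2))
    ultimately show ?thesis using 2 by (simp add: score_field_def)
  next
    case 3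
    then show ?thesis by (simp add: score_field_def)
  qed
qed

lemma divergence_weighted_score_field:
  fixes \<theta> :: "real \<Rightarrow> real"
  assumes AB: "primitives A B" and \<theta>: "\<And>u. (\<theta> has_real_derivative \<theta>' u) (at u)"
  shows "divergence (\<lambda>y. p y *\<^sub>R (\<theta> (y $ i) *\<^sub>R score_field A B y)) x =
     (\<theta>' (x $ i) + \<theta> (x $ i) * score q (x $ i)) * p x"
proof -
  let ?s = "score q (x $ i)" and ?t = "\<theta> (x $ i)"
  have "divergence (\<lambda>y. p y *\<^sub>R (\<theta> (y $ i) *\<^sub>R score_field A B y)) x =
     (\<Sum>k\<in>UNIV. if k = i then \<theta>' (x $ i) * p x + ?t * G x $ i
         else if k = other then ?t * (?s * p x - G x $ i) else 0)"
    unfolding divergence_def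
    by (rule sum.cong[OF refl]) (rule dir_deriv_eq(1)[OF weighted_score_field_partial[OF AB \<theta>]])
  also have "\<dots> = \<theta>' (x $ i) * p x + ?t * G x $ i +
      (\<Sum>k\<in>UNIV - {i}. if k = other then ?t * (?s * p x - G x $ i) else 0)"
    by (simp add: sum.remove[OF finite UNIV_I[of i]])
  also have "(\<Sum>k\<in>UNIV - {i}. if k = other then ?t * (?s * p x - G x $ i) else 0) =
      ?t * (?s * p x - G x $ i)"
  proof (cases "other = i")
    \<comment> \<open>The sum is 0 here, since \<open>other\<close> lies outside its range; the
      right-hand side is 0 because \<open>p\<close> solves the score equation in dimension
      one.\<close>
    case True
    from score_single_coordinate[OF single_coordinate_if_other_eq[OF this], of x] show ?thesis
      by simp
  next
    case False
    then show ?thesis by (subst sum.delta) auto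
  qed
  finally show ?thesis
    by (simp add: algebra_simps)
qed

lemma solves_score_equation_score_field:
  assumes "primitives A B"
  shows "solves_score_equation p i (score_field A B)"
  unfolding solves_score_equation_def
proof (intro allI conjI)
  fix x
  have one: "((\<lambda>u. 1) has_real_derivative (\<lambda>u. 0) u) (at u)" for u :: real
    by simp
  show "dir_differentiable (axis j 1) (\<lambda>y. (p y *\<^sub>R score_field A B y) $ j) x" for j
    using dir_deriv_eq(2)[OF weighted_score_field_partial[OF assms one]] by simp
  show "1 / p x * divergence (\<lambda>y. p y *\<^sub>R score_field A B y) x = score q (x $ i)"
    using divergence_weighted_score_field[OF assms one, of x] pos[of x] by simp
qed

text \<open>For the weight \<open>T\<close> the divergence is \<open>(dT + T * score q) * p\<close>,
  whose bracket collapses to the mean minus the coordinate. For regularity, each component times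
  \<open>p\<close> is brought into the form \<open>dq (x $ i) * a x + b x\<close> with C1 functions
  \<open>a\<close> and \<open>b\<close>.\<close>

lemma stein_kernel_score_field:
  assumes AB: "primitives A B"
  shows "stein_kernel p i (\<lambda>x. T (x $ i) *\<^sub>R score_field A B x)"
  unfolding stein_kernel_def
proof (intro conjI allI)
  have UNIV: "{x. 0 < p x} = UNIV" using pos by auto
  then show "open {x. 0 < p x}" by simp
  show "is_pdf p" "integrable lborel (\<lambda>x. p x *\<^sub>R x)"
    by (rule pdf integrable_first_moment)+
  \<comment> \<open>The equation holds at every point, which is more than the definition
    asks.\<close>
  have "1 / p x * divergence (\<lambda>y. p y *\<^sub>R (T (y $ i) *\<^sub>R score_field A B y)) x = pdf_mean p $ i - x $ i" for x
    unfolding divergence_weighted_score_field[OF AB T_derivative] using pos[of x] by simp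
  then show "AE x in lebesgue. 0 < p x \<longrightarrow>
      1 / p x * divergence (\<lambda>y. p y *\<^sub>R (T (y $ i) *\<^sub>R score_field A B y)) x = pdf_mean p $ i - x $ i"
    by simp
  fix k
  obtain A' B' where A: "C1 A A'" and B: "C1 B B'"
    using AB unfolding primitives_def by blast
  have dT: "continuous_on UNIV (\<lambda>u. dT u)" by (rule continuous_dT)
  have CT: "\<exists>T'. C1 (\<lambda>x. c * T (x $ i)) T'" for c
    using C1_mult[OF C1_const[of c] C1_component[OF T_derivative dT]] by (intro exI)
  have Cq: "\<exists>Q'. C1 (\<lambda>x. inverse (q (x $ i))) Q'"
  proof -
    have d: "((\<lambda>u. inverse (q u)) has_real_derivative - (dq u / (q u)\<^sup>2)) (at u)" for u
      using q_pos[of u] q_derivative[of u]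
      by (auto intro!: derivative_eq_intros simp: field_simps power2_eq_square)
    have c: "continuous_on UNIV (\<lambda>u. - (dq u / (q u)\<^sup>2))"
      by (intro continuous_intros continuous_dq continuous_q) (metis less_irrefl q_pos power_eq_0_iff)
    show ?thesis
      using C1_component[OF d c] by (intro exI)
  qed
  \<comment> \<open>The factors 1 and -1 only shape the products so that \<open>C1_mult\<close>
    yields the two terms below.\<close>
  obtain T1 where T1: "C1 (\<lambda>x. 1 * T (x $ i)) T1" using CT by blast
  obtain Tm where Tm: "C1 (\<lambda>x. (-1) * T (x $ i)) Tm" using CT by blast
  obtain Q' where Q': "C1 (\<lambda>x. inverse (q (x $ i))) Q'" using Cq by blast
  have z: "C1 (\<lambda>x::real^'n. 0) (\<lambda>x. 0)" by (rule C1_const)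
  have "ACL1_loc UNIV (\<lambda>x. (T (x $ i) *\<^sub>R score_field A B x) $ k * p x)"
  proof -
    consider "k = i" | "k \<noteq> i" "k = other" | "k \<noteq> i" "k \<noteq> other" by blast
    then show ?thesis
    proof cases
      case 1
      then show ?thesis
        using ACL1_loc_component[OF z C1_mult[OF T1 C1_p]] by (simp add: score_field_def)
    next
      case 2
      \<comment> \<open>The density cancels, and writing the score as \<open>dq / q\<close> isolates
        \<open>dq\<close>, which is only known to be absolutely continuous, from the C1 factors
        \<open>T\<close>, \<open>1 / q\<close> and \<open>A\<close>.\<close>
      have "(T (x $ i) *\<^sub>R score_field A B x) $ k * p x =
          dq (x $ i) * (1 * T (x $ i) * inverse (q (x $ i)) * A x) + (-1) * T (x $ i) * B x" for x
        using 2 pos[of x] by (simp add: score_field_def score_q field_simps)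
      then show ?thesis
        using ACL1_loc_component[OF C1_mult[OF C1_mult[OF T1 Q'] A] C1_mult[OF Tm B]] by simp
    next
      case 3
      then show ?thesis
        using ACL1_loc_component[OF z z] by (simp add: score_field_def)
    qed
  qed
  then show "ACL1_loc {x. 0 < p x} (\<lambda>x. (T (x $ i) *\<^sub>R score_field A B x) $ k * p x)"
    by (simp only: UNIV)
qed

end

theorem theorem4p12:
  fixes p :: "real ^ 'n \<Rightarrow> real" and i :: 'n
  assumes pos: "\<forall>x. 0 < p x"
    and pdf: "is_pdf p"
    and C2: "twice_cont_differentiable p"
    and fisher: "integrable lborel (\<lambda>x. (norm (gradient p x))\<^sup>2 / p x)"
    and hess: "integrable lborel (\<lambda>x. norm (hessian p x))"
    and variance: "integrable lborel (\<lambda>x. (norm x)\<^sup>2 * p x)"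
  shows "\<exists>(\<tau> :: real ^ 'n \<Rightarrow> real ^ 'n) (\<kappa> :: real ^ 'n \<Rightarrow> real ^ 'n).
           stein_kernel p i \<tau> \<and>
           (\<forall>x. \<tau> x = stein_kernel_1d (marginal p i) (x $ i) *\<^sub>R \<kappa> x) \<and>
           (\<forall>x. \<kappa> x $ i = 1) \<and>
           solves_score_equation p i \<kappa> \<and>
           (\<forall>x. \<tau> x $ i = stein_kernel_1d (marginal p i) (x $ i))"
proof -
  obtain G H where "\<And>x. (p has_derivative (\<lambda>h. G x \<bullet> h)) (at x)"
    "\<And>x. (G has_derivative (\<lambda>h. H x *v h)) (at x)" "continuous_on UNIV H"
    using C2 unfolding twice_cont_differentiable_def by blast
  then interpret C2_density p i G H
    using assms by unfold_locales auto
  obtain A B where AB: "primitives A B"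
    using ex_primitives by blast
  show ?thesis
    using stein_kernel_score_field[OF AB] solves_score_equation_score_field[OF AB]
    by (intro exI[of _ "\<lambda>x. T (x $ i) *\<^sub>R score_field A B x"] exI[of _ "score_field A B"])
      (simp add: score_field_def)
qed

end
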